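(* Let $s\ge 0$ be an integer. Consider the Markov jump linear system $$x_{k+1}=A_{\theta(k)}x_k+G_{\theta(k)}w_k,\qquad y_k=L_{\theta(k)}x_k+H_{\theta(k)}w_k,\qquad k\ge 0,$$ under the assumptions given in the context, together with the observer $$\widehat x_{k+1}=A_{\theta(k)}\widehat x_k+M_k\,(y_k-L_{\theta(k)}\widehat x_k),\qquad \widehat x_0=\bar x .$$ Let $S_1,\dots,S_{N_C}$ be a partition of $\{1,\dots,N\}$, let $\rho(k)\in\{1,\dots,N_C\}$ be the index of the class containing $\theta(k)$, and let $p_{\ell_0,\dots,\ell_{k-1},i,k}$, $Y_{\ell_0,\dots,\ell_{k-1},i,k}$, $X_{\ell_0,\dots,\ell_{k-1},i,k}(M)$ and the clustered information linear minimum mean square estimator (CLMMSE) be as defined in the context. Given the realization of $\theta(k)$, $k\le s$, and the corresponding cluster observations $\rho(0),\dots,\rho(s-1)$: (i) The gains $M^\star=\{M_0^\star,\dots,M_s^\star\}$ of the CLMMSE, that is, feasible gains attaining $$\min_{M_0,\dots,M_s}E\{\|x_s-\widehat x_s\|^2\mid\mathcal R_s\}$$ over feasible gains, where $\mathcal R_s=\{\rho(0),\dots,\rho(s),y(0),\dots,y(s),\theta(s)\}$, can be computed for each $0\le k\le s$ as $$M_k^\star=\begin{cases}0, & \text{if } p_{\rho(0),\dots,\rho(k-1),\theta(k),k}=0,\\[4pt] A_{\theta(k)}\,Y_{\rho(0),\dots,\rho(k-1),\theta(k),k}\,L_{\theta(k)}'\Big(L_{\theta(k)}\,Y_{\rho(0),\dots,\rho(k-1),\theta(k),k}\,L_{\theta(k)}'+p_{\rho(0),\dots,\rho(k-1),\theta(k),k}\,H_{\theta(k)}H_{\theta(k)}'\Big)^{-1},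 & \text{otherwise.}\end{cases}$$ (ii) The conditional second moment of the estimation error (in the unnormalized form $X$) is given, for each $0\le k\le s$, by $$X_{\rho(0),\dots,\rho(k-1),\theta(k),k}(M^\star)=Y_{\rho(0),\dots,\rho(k-1),\theta(k),k}.$$ (iii) It is optimal in the sense that, for any feasible gain sequence $M=\{M_0,\dots,M_s\}$, $$X_{\rho(0),\dots,\rho(k-1),\theta(k),k}(M^\star)\le X_{\rho(0),\dots,\rho(k-1),\theta(k),k}(M),\qquad 0\le k\le s.$$
   Context: Throughout, $'$ denotes transpose, $\|\cdot\|$ is the Euclidean norm, and inequalities between symmetric matrices are in the positive semidefinite order; $U>0$ means positive definite. $\mathbf 1_{\{\cdot\}}$ is the indicator function. System. $\theta(k)$, $k\ge0$, is a Markov chain with finite state space $\{1,\dots,N\}$, transition probabilities $p_{ji}=\Pr(\theta(k+1)=i\mid\theta(k)=j)$, and initial distribution $\pi_i(0)=\Pr(\theta(0)=i)$. For $1\le i\le N$, $A_i,G_i,L_i,H_i$ are real matrices of compatible dimensions satisfying $G_iH_i'=0$ and $H_iH_i'>0$. The initial state $x_0$ is normal with mean $\bar x$ and covariance matrix $\Psi$. The noise sequence $w$ is independent from $x_0$ and the Markov chain $\theta$, with $E[w_k]=0$ and $E[w_kw_k']$ equal to the identity matrix for all $k$. The observations $y_k$ are also written $y(k)$. Clusters. $S_1,\dots,S_{N_C}$ is a partition of $\{1,\dots,N\}$ and $\rho(k)=\sum_{m=1}^{N_C}m\,\mathbf 1_{\{\theta(k)\in S_m\}}$. Feasible gains. A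 gain sequence $M=\{M_0,\dots,M_s\}$ is feasible if, for each $k$, $M_k=h_k(\rho(0),\dots,\rho(k-1),\theta(k))$ for some measurable function $h_k$ (for $k=0$, $M_0=h_0(\theta(0))$). CLMMSE. The clustered information linear minimum mean square estimator is the observer $\widehat x_{k+1}=A_{\theta(k)}\widehat x_k+M_k(y_k-L_{\theta(k)}\widehat x_k)$, $\widehat x_0=\bar x$, whose gains solve the problem of minimizing $E\{\|x_s-\widehat x_s\|^2\mid\mathcal R_s\}$ over feasible gains $M_0,\dots,M_s$, where $\mathcal R_s=\{\rho(0),\dots,\rho(s),y(0),\dots,y(s),\theta(s)\}$. Error and its second moments. For a feasible gain sequence $M$, let $\widetilde x_k=x_k-\widehat x_k$ be the estimation error produced by the observer with gains $M$. For $k\ge0$, $1\le i\le N$ and $1\le\ell_m\le N_C$ ($0\le m\le k-1$), set $$X_{\ell_0,\dots,\ell_{k-1},i,k}(M)=E\big(\widetilde x_k\widetilde x_k'\,\mathbf 1_{\{\rho(0)=\ell_0,\dots,\rho(k-1)=\ell_{k-1},\,\theta(k)=i\}}\big),$$ $$p_{\ell_0,\dots,\ell_{k-1},i,k}=\Pr(\rho(0)=\ell_0,\dots,\rho(k-1)=\ell_{k-1},\theta(k)=i).$$ For $k=0$ there are no indices $\ell$: $X_{i,0}(M)=E(\widetilde x_0\widetilde x_0'\mathbf 1_{\{\theta(0)=i\}})$ and $p_{i,0}=\pi_i(0)$. When the probability $p_{\ell_0,\dots,\ell_{k-1},i,k}$ is nonzero, $X$ divided by it is the conditional error second moment matrix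 given $\rho(0)=\ell_0,\dots,\rho(k-1)=\ell_{k-1},\theta(k)=i$. Coupled Riccati recursion. $Y_{i,0}=\pi_i(0)\Psi$ for $1\le i\le N$. For $k\ge1$, $1\le i\le N$ and $1\le\ell_m\le N_C$ ($0\le m\le k-1$): $Y_{\ell_0,\dots,\ell_{k-1},i,k}=0$ if $p_{\ell_0,\dots,\ell_{k-1},i,k}=0$; otherwise, writing $Y_j=Y_{\ell_0,\dots,\ell_{k-2},j,k-1}$ and $q_j=p_{\ell_0,\dots,\ell_{k-2},j,k-1}$, $$Y_{\ell_0,\dots,\ell_{k-1},i,k}=\sum_{j\in\widetilde S}p_{ji}\Big[A_jY_jA_j'+q_jG_jG_j'-A_jY_jL_j'\big(L_jY_jL_j'+q_jH_jH_j'\big)^{-1}L_jY_jA_j'\Big],$$ where $\widetilde S=\{j\in S_{\ell_{k-1}}: q_j\ne0\}$.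
   Formalization: In (i), E{‖x_s−x̂_s‖²|R_s} is compared a.s. after averaging over y(0..s) given ρ(0),…,ρ(s),θ(s), since no gains minimize it pointwise in the observations; also assumed: E[w_k w_m']=0 for k≠m and x_0 independent of θ (w independent of the pair). *)

theory Defs
  imports "HOL-Probability.Probability"
begin

definition outer :: "real ^ 'm \<Rightarrow> real ^ 'n \<Rightarrow> real ^ 'n ^ 'm" where
  "outer u v = (\<chi> i j. u $ i * v $ j)"

definition pos_def :: "real ^ 'n ^ 'n \<Rightarrow> bool" where
  "pos_def U \<longleftrightarrow> transpose U = U \<and> (\<forall>v. v \<noteq> 0 \<longrightarrow> 0 < v \<bullet> (U *v v))"

definition pos_semidef :: "real ^ 'n ^ 'n \<Rightarrow> bool" where
  "pos_semidef U \<longleftrightarrow> transpose U = U \<and> (\<forall>v. 0 \<le> v \<bullet> (U *v v))"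

definition loewner_le :: "real ^ 'n ^ 'n \<Rightarrow> real ^ 'n ^ 'n \<Rightarrow> bool" where
  "loewner_le U V \<longleftrightarrow> transpose U = U \<and> transpose V = V \<and> pos_semidef (V - U)"

text \<open>A random vector is normal if all its linear functionals are normal; the covariance
  matrix may be singular, in which case some of the functionals are almost surely constant.\<close>

definition normal_vec ::
  "'w measure \<Rightarrow> ('w \<Rightarrow> real ^ 'n) \<Rightarrow> real ^ 'n \<Rightarrow> real ^ 'n ^ 'n \<Rightarrow> bool" where
  "normal_vec P X \<mu> C \<longleftrightarrow> X \<in> borel_measurable P \<and> pos_semidef C \<and>
     (\<forall>a. if a \<bullet> (C *v a) = 0 then AE \<omega> in P. a \<bullet> X \<omega> = a \<bullet> \<mu>
          else distributed P lborel (\<lambda>\<omega>. a \<bullet> X \<omega>)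
                 (normal_density (a \<bullet> \<mu>) (sqrt (a \<bullet> (C *v a)))))"

definition sigma_of :: "'w measure \<Rightarrow> 'b measure \<Rightarrow> ('w \<Rightarrow> 'b) \<Rightarrow> 'w set set" where
  "sigma_of P B X = {X -` E \<inter> space P | E. E \<in> sets B}"

text \<open>Homogeneous Markov chain on \<open>{1..N}\<close>; the entry \<open>p j i\<close> is the probability of jumping
  from \<open>j\<close> to \<open>i\<close>.\<close>

definition markov_chain ::
  "'w measure \<Rightarrow> nat \<Rightarrow> (nat \<Rightarrow> 'w \<Rightarrow> nat) \<Rightarrow> (nat \<Rightarrow> nat \<Rightarrow> real) \<Rightarrow> (nat \<Rightarrow> real) \<Rightarrow> bool" where
  "markov_chain P N \<theta> p \<pi>0 \<longleftrightarrow>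
     (\<forall>k. \<theta> k \<in> P \<rightarrow>\<^sub>M count_space UNIV) \<and>
     (\<forall>k. \<forall>\<omega>\<in>space P. \<theta> k \<omega> \<in> {1..N}) \<and>
     (\<forall>j\<in>{1..N}. (\<forall>i\<in>{1..N}. 0 \<le> p j i) \<and> (\<Sum>i=1..N. p j i) = 1) \<and>
     (\<forall>i\<in>{1..N}. \<P>(\<omega> in P. \<theta> 0 \<omega> = i) = \<pi>0 i) \<and>
     (\<forall>k a. \<forall>i\<in>{1..N}. \<P>(\<omega> in P. \<forall>m\<le>k. \<theta> m \<omega> = a m) \<noteq> 0 \<longrightarrow>
        \<P>(\<omega> in P. \<theta> (Suc k) \<omega> = i \<bar> \<forall>m\<le>k. \<theta> m \<omega> = a m) = p (a k) i)"

definition is_partition :: "nat \<Rightarrow> nat \<Rightarrow> (nat \<Rightarrow> nat set) \<Rightarrow> bool" where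
  "is_partition N NC S \<longleftrightarrow> partition_on {1..N} (S ` {1..NC}) \<and> inj_on S {1..NC}"

definition cluster :: "nat \<Rightarrow> (nat \<Rightarrow> nat set) \<Rightarrow> (nat \<Rightarrow> 'w \<Rightarrow> nat) \<Rightarrow> nat \<Rightarrow> 'w \<Rightarrow> nat" where
  "cluster NC S \<theta> k \<omega> = (\<Sum>m=1..NC. m * indicator (S m) (\<theta> k \<omega>))"

text \<open>In the following, an index string \<open>\<ell>\<^sub>0, \<dots>, \<ell>\<^sub>k\<^sub>-\<^sub>1\<close> is the restriction of a function
  \<open>l :: nat \<Rightarrow> nat\<close> to arguments below \<open>k\<close>; its other values are irrelevant.\<close>

definition path_event ::
  "'w measure \<Rightarrow> (nat \<Rightarrow> 'w \<Rightarrow> nat) \<Rightarrow> (nat \<Rightarrow> 'w \<Rightarrow> nat) \<Rightarrow> (nat \<Rightarrow> nat) \<Rightarrow> nat \<Rightarrow> nat \<Rightarrow> 'w set" where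
  "path_event P \<rho> \<theta> l i k = {\<omega> \<in> space P. (\<forall>m<k. \<rho> m \<omega> = l m) \<and> \<theta> k \<omega> = i}"

definition path_prob ::
  "'w measure \<Rightarrow> (nat \<Rightarrow> 'w \<Rightarrow> nat) \<Rightarrow> (nat \<Rightarrow> 'w \<Rightarrow> nat) \<Rightarrow> (nat \<Rightarrow> nat) \<Rightarrow> nat \<Rightarrow> nat \<Rightarrow> real" where
  "path_prob P \<rho> \<theta> l i k = measure P (path_event P \<rho> \<theta> l i k)"

text \<open>The first argument is the vector \<open>(\<rho>(0), \<dots>, \<rho>(k-1))\<close>. It takes finitely many values,
  and every function on a countable discrete space is measurable.\<close>

definition feasible ::
  "'w measure \<Rightarrow> (nat \<Rightarrow> 'w \<Rightarrow> nat) \<Rightarrow> (nat \<Rightarrow> 'w \<Rightarrow> nat) \<Rightarrow> nat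
    \<Rightarrow> (nat \<Rightarrow> 'w \<Rightarrow> real ^ 'q ^ 'n) \<Rightarrow> bool" where
  "feasible P \<rho> \<theta> s M \<longleftrightarrow>
     (\<forall>k\<le>s. \<exists>h. h \<in> count_space (UNIV :: (nat list \<times> nat) set) \<rightarrow>\<^sub>M borel \<and>
        (\<forall>\<omega>\<in>space P. M k \<omega> = h (map (\<lambda>m. \<rho> m \<omega>) [0..<k], \<theta> k \<omega>)))"

primrec observer ::
  "(nat \<Rightarrow> real ^ 'n ^ 'n) \<Rightarrow> (nat \<Rightarrow> real ^ 'n ^ 'q) \<Rightarrow> (nat \<Rightarrow> 'w \<Rightarrow> nat)
    \<Rightarrow> (nat \<Rightarrow> 'w \<Rightarrow> real ^ 'q) \<Rightarrow> real ^ 'n \<Rightarrow> (nat \<Rightarrow> 'w \<Rightarrow> real ^ 'q ^ 'n)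
    \<Rightarrow> nat \<Rightarrow> 'w \<Rightarrow> real ^ 'n" where
  "observer A L \<theta> y xbar M 0 = (\<lambda>\<omega>. xbar)"
| "observer A L \<theta> y xbar M (Suc k) = (\<lambda>\<omega>.
     A (\<theta> k \<omega>) *v observer A L \<theta> y xbar M k \<omega>
     + M k \<omega> *v (y k \<omega> - L (\<theta> k \<omega>) *v observer A L \<theta> y xbar M k \<omega>))"

definition obs_info ::
  "'w measure \<Rightarrow> (nat \<Rightarrow> 'w \<Rightarrow> nat) \<Rightarrow> (nat \<Rightarrow> 'w \<Rightarrow> nat) \<Rightarrow> (nat \<Rightarrow> 'w \<Rightarrow> real ^ 'q) \<Rightarrow> nat \<Rightarrow> 'w measure" where
  "obs_info P \<rho> \<theta> y s = sigma (space P)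
     ((\<Union>k\<in>{..s}. sigma_of P (count_space UNIV) (\<rho> k)) \<union>
      (\<Union>k\<in>{..s}. sigma_of P borel (y k)) \<union>
      sigma_of P (count_space UNIV) (\<theta> s))"

definition mode_info ::
  "'w measure \<Rightarrow> (nat \<Rightarrow> 'w \<Rightarrow> nat) \<Rightarrow> (nat \<Rightarrow> 'w \<Rightarrow> nat) \<Rightarrow> nat \<Rightarrow> 'w measure" where
  "mode_info P \<rho> \<theta> s = sigma (space P)
     ((\<Union>k\<in>{..s}. sigma_of P (count_space UNIV) (\<rho> k)) \<union>
      sigma_of P (count_space UNIV) (\<theta> s))"

definition cond_mse ::
  "'w measure \<Rightarrow> 'w measure \<Rightarrow> (nat \<Rightarrow> 'w \<Rightarrow> real ^ 'n) \<Rightarrow> (nat \<Rightarrow> 'w \<Rightarrow> real ^ 'n) \<Rightarrow> nat \<Rightarrow> 'w \<Rightarrow> real" where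
  "cond_mse P R x xh s = real_cond_exp P R (\<lambda>\<omega>. (norm (x s \<omega> - xh s \<omega>))\<^sup>2)"

text \<open>The objective \<^const>\<open>cond_mse\<close>, that is \<open>E(\<parallel>x\<^sub>s - xh\<^sub>s\<parallel>\<^sup>2 | R\<^sub>s)\<close>, is a random variable that depends on the
  observations, while the gains do not. Hence no gain sequence minimizes it for every
  realization of the observations in general: with one mode and \<open>s = 1\<close>, given \<open>y\<^sub>0, y\<^sub>1\<close> the
  objective is lowered by moving \<open>M\<^sub>0\<close> so that the predictor gets closer to the filtered state.
  Objectives are therefore compared after averaging out the observations, separately (almost
  surely) for each realization of the mode information \<open>\<rho>(0), \<dots>, \<rho>(s), \<theta>(s)\<close> in \<open>R\<^sub>s\<close>.
  This implies optimality of the mean of the objective.\<close>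

definition is_clmmse ::
  "'w measure \<Rightarrow> (nat \<Rightarrow> 'w \<Rightarrow> nat) \<Rightarrow> (nat \<Rightarrow> 'w \<Rightarrow> nat)
    \<Rightarrow> (nat \<Rightarrow> real ^ 'n ^ 'n) \<Rightarrow> (nat \<Rightarrow> real ^ 'n ^ 'q)
    \<Rightarrow> (nat \<Rightarrow> 'w \<Rightarrow> real ^ 'n) \<Rightarrow> (nat \<Rightarrow> 'w \<Rightarrow> real ^ 'q) \<Rightarrow> real ^ 'n \<Rightarrow> nat
    \<Rightarrow> (nat \<Rightarrow> 'w \<Rightarrow> real ^ 'q ^ 'n) \<Rightarrow> bool" where
  "is_clmmse P \<rho> \<theta> A L x y xbar s M \<longleftrightarrow> feasible P \<rho> \<theta> s M \<and>
     (\<forall>M'. feasible P \<rho> \<theta> s M' \<longrightarrow>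
        (AE \<omega> in P.
           real_cond_exp P (mode_info P \<rho> \<theta> s)
             (cond_mse P (obs_info P \<rho> \<theta> y s) x (observer A L \<theta> y xbar M) s) \<omega>
           \<le> real_cond_exp P (mode_info P \<rho> \<theta> s)
             (cond_mse P (obs_info P \<rho> \<theta> y s) x (observer A L \<theta> y xbar M') s) \<omega>))"

definition err_moment ::
  "'w measure \<Rightarrow> (nat \<Rightarrow> 'w \<Rightarrow> nat) \<Rightarrow> (nat \<Rightarrow> 'w \<Rightarrow> nat)
    \<Rightarrow> (nat \<Rightarrow> 'w \<Rightarrow> real ^ 'n) \<Rightarrow> (nat \<Rightarrow> 'w \<Rightarrow> real ^ 'n)
    \<Rightarrow> (nat \<Rightarrow> nat) \<Rightarrow> nat \<Rightarrow> nat \<Rightarrow> real ^ 'n ^ 'n" where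
  "err_moment P \<rho> \<theta> x xh l i k =
     (\<integral>\<omega>. indicator (path_event P \<rho> \<theta> l i k) \<omega> *\<^sub>R
            outer (x k \<omega> - xh k \<omega>) (x k \<omega> - xh k \<omega>) \<partial>P)"

text \<open>Here \<open>q\<close> stands for the path probabilities \<^const>\<open>path_prob\<close> and \<open>p\<close> for the transition
  probabilities.\<close>

primrec riccati ::
  "(nat \<Rightarrow> real ^ 'n ^ 'n) \<Rightarrow> (nat \<Rightarrow> real ^ 'r ^ 'n) \<Rightarrow> (nat \<Rightarrow> real ^ 'n ^ 'q)
    \<Rightarrow> (nat \<Rightarrow> real ^ 'r ^ 'q) \<Rightarrow> (nat \<Rightarrow> nat \<Rightarrow> real) \<Rightarrow> (nat \<Rightarrow> real) \<Rightarrow> real ^ 'n ^ 'n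
    \<Rightarrow> (nat \<Rightarrow> nat set) \<Rightarrow> ((nat \<Rightarrow> nat) \<Rightarrow> nat \<Rightarrow> nat \<Rightarrow> real)
    \<Rightarrow> (nat \<Rightarrow> nat) \<Rightarrow> nat \<Rightarrow> nat \<Rightarrow> real ^ 'n ^ 'n" where
  "riccati A G L H p \<pi>0 \<Psi> S q l 0 = (\<lambda>i. \<pi>0 i *\<^sub>R \<Psi>)"
| "riccati A G L H p \<pi>0 \<Psi> S q l (Suc k) = (\<lambda>i.
     if q l i (Suc k) = 0 then 0
     else (\<Sum>j \<in> {j \<in> S (l k). q l j k \<noteq> 0}.
       let Y = riccati A G L H p \<pi>0 \<Psi> S q l k j in
       p j i *\<^sub>R
         (A j ** Y ** transpose (A j) + q l j k *\<^sub>R (G j ** transpose (G j))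
          - A j ** Y ** transpose (L j)
            ** matrix_inv (L j ** Y ** transpose (L j) + q l j k *\<^sub>R (H j ** transpose (H j)))
            ** L j ** Y ** transpose (A j))))"

end

theory Submission
  imports Defs
begin

text \<open>
  Write \<open>e\<^sub>k\<close> for the estimation error. Substituting the observation into the observer gives
  \<open>e\<^sub>k\<^sub>+\<^sub>1 = (A - M\<^sub>k L) e\<^sub>k + (G - M\<^sub>k H) w\<^sub>k\<close>, with the matrices of the current mode. A feasible gain is
  a function of the modes alone, so along a fixed mode path this is a linear recursion with
  deterministic coefficients. The noise is white and independent of the initial state and the
  modes, and the initial state is independent of the modes. Hence, restricted to a mode path of
  probability \<open>c\<close>, the second moment of the error is \<open>c\<close> times a deterministic matrix given by a
  Lyapunov recursion (\<open>lin_err_moment_on_path\<close>).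

  All mode paths with the same cluster history and the same current mode receive the same gain.
  Summing over them, and using the Markov property for the next transition, gives an exact
  recursion for the unnormalized moments \<open>X\<close> (\<open>err_moment_Suc\<close>): the moment of the next step is a
  sum, weighted by the transition probabilities, of error updates of the moments of the current
  step.

  The error update is a quadratic polynomial in the gain. Completing the square, with \<open>G H' = 0\<close>, shows
  that it equals the bracket of the Riccati recursion plus \<open>(M - K) D (M - K)'\<close>, where \<open>K\<close> is the Riccati
  gain and \<open>D\<close> is positive definite because \<open>H H'\<close> is (\<open>error_update_complete_square\<close>). The error update
  is also monotone in the moment it starts from (\<open>riccati_gain_optimal\<close>). By induction on time, the
  moments of the Riccati gains coincide with \<open>Y\<close> (\<open>err_moment_optimal_eq\<close>), and \<open>Y\<close> is a lower bound
  in the positive semidefinite order for the moments of every feasible gain sequence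
  (\<open>riccati_le_err_moment\<close>). There is no trade-off between times: smaller moments now lead to
  smaller moments later.

  For the estimator itself, conditioning on the observations disappears by the tower property.
  The mode information is generated by the finitely many events that fix the cluster history and
  the current mode, and the mean square error over such an event is the trace of an \<open>X\<close>. The
  comparison of the \<open>X\<close> therefore gives the comparison of the conditional mean square errors
  (\<open>clmmse_opt\<close>).
\<close>

section \<open>Matrix algebra and the positive semidefinite order\<close>

lemma matrix_add_rdistrib: "(B + C) ** A = B ** A + C ** (A :: real ^ 'a ^ 'b)"
  by (simp add: matrix_matrix_mult_def vec_eq_iff sum.distrib distrib_right)

lemma matrix_diff_ldistrib: "A ** (B - C) = A ** B - A ** (C :: real ^ 'a ^ 'b)"
  by (simp add: matrix_matrix_mult_def vec_eq_iff sum_subtractf right_diff_distrib)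

lemma matrix_diff_rdistrib: "(B - C) ** A = B ** A - C ** (A :: real ^ 'a ^ 'b)"
  by (simp add: matrix_matrix_mult_def vec_eq_iff sum_subtractf left_diff_distrib)

lemma transpose_add: "transpose (A + B) = transpose A + transpose (B :: real ^ 'a ^ 'b)"
  by (simp add: transpose_def vec_eq_iff)

lemma transpose_diff: "transpose (A - B) = transpose A - transpose (B :: real ^ 'a ^ 'b)"
  by (simp add: transpose_def vec_eq_iff)

lemma scaleR_mult_matrix: "(c *\<^sub>R A) ** B = c *\<^sub>R (A ** (B :: real ^ 'a ^ 'b))"
  by (simp add: matrix_matrix_mult_def vec_eq_iff sum_distrib_left mult.assoc)

lemma mult_scaleR_matrix: "A ** (c *\<^sub>R B) = c *\<^sub>R (A ** (B :: real ^ 'a ^ 'b))"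
  by (simp add: matrix_matrix_mult_def vec_eq_iff sum_distrib_left mult.left_commute)

lemma zero_mult_matrix: "0 ** (B :: real ^ 'a ^ 'b) = 0"
  and mult_zero_matrix: "(B :: real ^ 'a ^ 'b) ** 0 = 0"
  by (simp_all add: matrix_matrix_mult_def vec_eq_iff)

lemma transpose_zero: "transpose (0 :: real ^ 'a ^ 'b) = 0"
  by (simp add: transpose_def vec_eq_iff)

lemmas matrix_ring_simps =
  matrix_add_ldistrib matrix_add_rdistrib matrix_diff_ldistrib matrix_diff_rdistrib
  matrix_mul_assoc matrix_transpose_mul transpose_add transpose_diff transpose_scalar
  scaleR_mult_matrix mult_scaleR_matrix zero_mult_matrix mult_zero_matrix

lemma congruence_bounded_linear:
  "bounded_linear (\<lambda>X :: real ^ 'a ^ 'b. F ** X ** (E :: real ^ 'd ^ 'a))"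
  unfolding linear_conv_bounded_linear[symmetric]
  by (rule linearI) (simp_all add: matrix_ring_simps)

lemma transpose_bounded_linear: "bounded_linear (transpose :: real ^ 'a ^ 'b \<Rightarrow> _)"
  unfolding linear_conv_bounded_linear[symmetric]
  by (rule linearI) (simp_all add: matrix_ring_simps)

lemma matrix_mult_sum_right:
  "A ** (\<Sum>i\<in>I. f i) = (\<Sum>i\<in>I. A ** (f i :: real ^ 'a ^ 'b))"
  by (induction I rule: infinite_finite_induct) (simp_all add: matrix_ring_simps)

lemma matrix_mult_sum_left:
  "(\<Sum>i\<in>I. f i) ** A = (\<Sum>i\<in>I. f i ** (A :: real ^ 'a ^ 'b))"
  by (induction I rule: infinite_finite_induct) (simp_all add: matrix_ring_simps)

lemma outer_simps:
  "outer (u + u') v = outer u v + outer u' v"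
  "outer u (v + v') = outer u v + outer u v'"
  "outer (F *v u) v = F ** outer u v"
  "outer u (E *v v) = outer u v ** transpose E"
  "transpose (outer u v) = outer v u"
  by (simp_all add: outer_def vec_eq_iff algebra_simps matrix_vector_mult_def matrix_matrix_mult_def
      transpose_def sum_distrib_left sum_distrib_right)

lemma pos_semidef_add: "pos_semidef U \<Longrightarrow> pos_semidef V \<Longrightarrow> pos_semidef (U + V)"
  by (simp add: pos_semidef_def transpose_add matrix_vector_mult_add_rdistrib inner_add_right)

lemma pos_semidef_zero: "pos_semidef 0"
  by (simp add: pos_semidef_def transpose_def vec_eq_iff)

lemma pos_semidef_scaleR: "pos_semidef U \<Longrightarrow> 0 \<le> c \<Longrightarrow> pos_semidef (c *\<^sub>R U)"
  by (simp add: pos_semidef_def transpose_scalar flip: scaleR_matrix_vector_assoc)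

lemma pos_semidef_sum: "(\<And>i. i \<in> I \<Longrightarrow> pos_semidef (f i)) \<Longrightarrow> pos_semidef (\<Sum>i\<in>I. f i)"
  by (induction I rule: infinite_finite_induct) (auto simp: pos_semidef_zero pos_semidef_add)

lemma inner_congruence:
  fixes U :: "real ^ 'n ^ 'n"
  shows "v \<bullet> ((F ** U ** transpose F) *v v) = (transpose F *v v) \<bullet> (U *v (transpose F *v v))"
  by (metis dot_lmul_matrix matrix_vector_mul_assoc transpose_matrix_vector)

lemma pos_semidef_congruence: "pos_semidef U \<Longrightarrow> pos_semidef (F ** U ** transpose F)"
  by (simp add: pos_semidef_def inner_congruence matrix_ring_simps
      del: transpose_matrix_vector)

lemma pos_semidef_gram: "pos_semidef (F ** transpose F)"
  using pos_semidef_congruence[of "mat 1" F] by (simp add: pos_semidef_def)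

lemma pos_def_imp_semidef: "pos_def U \<Longrightarrow> pos_semidef U"
  unfolding pos_def_def pos_semidef_def by (metis inner_zero_left less_imp_le order_refl)

lemma loewner_le_iff:
  "pos_semidef U \<Longrightarrow> pos_semidef V \<Longrightarrow> loewner_le U V \<longleftrightarrow> pos_semidef (V - U)"
  by (simp add: loewner_le_def pos_semidef_def)

lemma pos_semidef_add_pos_def:
  "pos_semidef U \<Longrightarrow> pos_def V \<Longrightarrow> 0 < c \<Longrightarrow> pos_def (U + c *\<^sub>R V)"
  by (auto simp: pos_semidef_def pos_def_def transpose_add transpose_scalar
      matrix_vector_mult_add_rdistrib inner_add_right add_nonneg_pos
      simp flip: scaleR_matrix_vector_assoc)

lemma pos_def_matrix_inv:
  assumes "pos_def U"
  shows "U ** matrix_inv U = mat 1" "matrix_inv U ** U = mat 1"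
    "transpose (matrix_inv U) = matrix_inv U"
proof -
  have "x = 0" if "U *v x = 0" for x
    using assms that unfolding pos_def_def by (metis inner_zero_right less_irrefl)
  then have "\<exists>B. B ** U = mat 1"
    by (simp add: matrix_left_invertible_ker)
  then have "\<exists>V. U ** V = mat 1 \<and> V ** U = mat 1"
    using matrix_left_right_inverse by metis
  then have "U ** matrix_inv U = mat 1 \<and> matrix_inv U ** U = mat 1"
    unfolding matrix_inv_def by (rule someI_ex)
  then show *: "U ** matrix_inv U = mat 1" "matrix_inv U ** U = mat 1" by auto
  have "transpose (matrix_inv U) ** U = mat 1"
    using arg_cong[OF *(1), of transpose] assms
    by (simp add: matrix_transpose_mul pos_def_def)
  then show "transpose (matrix_inv U) = matrix_inv U"
    by (metis "*"(1) matrix_mul_assoc matrix_mul_lid matrix_mul_rid)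
qed

lemma trace_outer: "trace (outer u u) = (norm u)\<^sup>2" for u :: "real ^ 'n"
  by (simp add: trace_def outer_def power2_norm_eq_inner inner_vec_def)

lemma trace_bounded_linear: "bounded_linear (trace :: real ^ 'n ^ 'n \<Rightarrow> real)"
  unfolding linear_conv_bounded_linear[symmetric]
  by (rule linearI) (simp_all add: trace_def sum.distrib sum_distrib_left)

lemma trace_pos_semidef:
  fixes U :: "real ^ 'n ^ 'n"
  assumes "pos_semidef U" shows "0 \<le> trace U"
proof -
  have "U $ i $ i = axis i 1 \<bullet> (U *v axis i 1)" for i
    by (simp add: inner_axis' matrix_vector_mult_basis column_def)
  then show ?thesis using assms by (simp add: trace_def pos_semidef_def sum_nonneg)
qed

section \<open>The Riccati step as an optimal error update\<close>

text \<open>If \<open>Y\<close> is the error moment on an event of probability \<open>q\<close> on which the mode is fixed, this is the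
  error moment on that event one step later under the gain \<open>M\<close>. The noise enters through its
  covariance, the identity, weighted by \<open>q\<close>.\<close>

definition error_update ::
  "real ^ 'n ^ 'n \<Rightarrow> real ^ 'r ^ 'n \<Rightarrow> real ^ 'n ^ 'q \<Rightarrow> real ^ 'r ^ 'q \<Rightarrow> real ^ 'q ^ 'n
    \<Rightarrow> real \<Rightarrow> real ^ 'n ^ 'n \<Rightarrow> real ^ 'n ^ 'n" where
  "error_update A G L H M q Y =
     (A - M ** L) ** Y ** transpose (A - M ** L)
     + q *\<^sub>R ((G - M ** H) ** transpose (G - M ** H))"

text \<open>The unnormalized second moment of the innovation \<open>y\<^sub>k - L xh\<^sub>k\<close>.\<close>

definition innovation_cov ::
  "real ^ 'n ^ 'q \<Rightarrow> real ^ 'r ^ 'q \<Rightarrow> real \<Rightarrow> real ^ 'n ^ 'n \<Rightarrow> real ^ 'q ^ 'q" where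
  "innovation_cov L H q Y = L ** Y ** transpose L + q *\<^sub>R (H ** transpose H)"

definition riccati_gain ::
  "real ^ 'n ^ 'n \<Rightarrow> real ^ 'n ^ 'q \<Rightarrow> real ^ 'r ^ 'q \<Rightarrow> real \<Rightarrow> real ^ 'n ^ 'n \<Rightarrow> real ^ 'q ^ 'n" where
  "riccati_gain A L H q Y = A ** Y ** transpose L ** matrix_inv (innovation_cov L H q Y)"

lemma pos_def_innovation_cov:
  "pos_semidef Y \<Longrightarrow> pos_def (H ** transpose H) \<Longrightarrow> 0 < q \<Longrightarrow> pos_def (innovation_cov L H q Y)"
  unfolding innovation_cov_def by (intro pos_semidef_add_pos_def pos_semidef_congruence)

text \<open>The gain enters the update quadratically. The cross terms with the noise vanish since
  \<open>G H' = 0\<close>, the linear terms are \<open>- M L Y A' - A Y L' M'\<close>, and \<open>K D = A Y L'\<close>, so they are exactly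
  the mixed terms of \<open>(M - K) D (M - K)'\<close>.\<close>

lemma error_update_complete_square:
  fixes A :: "real ^ 'n ^ 'n" and G :: "real ^ 'r ^ 'n" and L :: "real ^ 'n ^ 'q"
    and M :: "real ^ 'q ^ 'n"
  assumes GH: "G ** transpose H = 0" and HH: "pos_def (H ** transpose H)"
    and Y: "pos_semidef Y" and q: "0 < q"
  defines "D \<equiv> innovation_cov L H q Y" and "K \<equiv> riccati_gain A L H q Y"
  shows "error_update A G L H M q Y =
      A ** Y ** transpose A + q *\<^sub>R (G ** transpose G)
      - A ** Y ** transpose L ** matrix_inv D ** L ** Y ** transpose A
      + (M - K) ** D ** transpose (M - K)"
proof -
  have D: "pos_def D" unfolding D_def by (rule pos_def_innovation_cov[OF Y HH q])
  note inv = pos_def_matrix_inv[OF D]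
  have HG: "H ** transpose G = 0"
    using arg_cong[OF GH, of transpose] transpose_zero by (simp add: matrix_transpose_mul)
  have Yt: "transpose Y = Y" using Y by (simp add: pos_semidef_def)
  have KD: "K ** D = A ** Y ** transpose L"
    unfolding K_def riccati_gain_def D_def[symmetric]
    by (metis inv(2) matrix_mul_assoc matrix_mul_rid)
  have DK: "D ** transpose K = L ** Y ** transpose A"
    using arg_cong[OF KD, of transpose] D by (simp add: matrix_ring_simps Yt pos_def_def)
  have KDK: "K ** D ** transpose K = A ** Y ** transpose L ** matrix_inv D ** L ** Y ** transpose A"
    unfolding KD unfolding K_def riccati_gain_def D_def[symmetric]
    by (simp add: matrix_ring_simps Yt inv)
  have "(M - K) ** D ** transpose (M - K)
      = M ** D ** transpose M - M ** (D ** transpose K) - K ** D ** transpose M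
        + K ** D ** transpose K"
    by (simp add: matrix_ring_simps)
  also have "\<dots> = M ** D ** transpose M - M ** (L ** Y ** transpose A)
      - A ** Y ** transpose L ** transpose M
      + A ** Y ** transpose L ** matrix_inv D ** L ** Y ** transpose A"
    unfolding DK KDK unfolding KD ..
  moreover have "G ** transpose H ** transpose M = 0" "M ** H ** transpose G = 0"
    unfolding GH using HG by (simp_all add: matrix_ring_simps flip: matrix_mul_assoc)
  ultimately show ?thesis
    unfolding error_update_def D_def innovation_cov_def
    by (simp add: matrix_ring_simps algebra_simps)
qed

lemma error_update_riccati_gain:
  assumes "G ** transpose H = 0" "pos_def (H ** transpose H)" "pos_semidef Y" "0 < q"
  shows "error_update A G L H (riccati_gain A L H q Y) q Y =
      A ** Y ** transpose A + q *\<^sub>R (G ** transpose G)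
      - A ** Y ** transpose L ** matrix_inv (innovation_cov L H q Y) ** L ** Y ** transpose A"
  by (simp add: error_update_complete_square[OF assms] matrix_ring_simps)

text \<open>This is the induction step of the comparison: replacing \<open>X\<close> by the smaller \<open>Y\<close> lowers the update
  by a congruence of \<open>X - Y\<close>, and replacing the gain by the Riccati gain of \<open>Y\<close> then lowers it by the
  completed square.\<close>

lemma riccati_gain_optimal:
  assumes GH: "G ** transpose H = 0" and HH: "pos_def (H ** transpose H)"
    and Y: "pos_semidef Y" and q: "0 < q" and le: "pos_semidef (X - Y)"
  shows "pos_semidef (error_update A G L H M q X
      - error_update A G L H (riccati_gain A L H q Y) q Y)"
proof -
  let ?K = "riccati_gain A L H q Y"
  have "error_update A G L H M q X - error_update A G L H ?K q Y =
      (A - M ** L) ** (X - Y) ** transpose (A - M ** L)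
      + (error_update A G L H M q Y - error_update A G L H ?K q Y)"
    by (simp add: error_update_def matrix_ring_simps algebra_simps)
  also have "error_update A G L H M q Y - error_update A G L H ?K q Y
      = (M - ?K) ** innovation_cov L H q Y ** transpose (M - ?K)"
    unfolding error_update_complete_square[OF GH HH Y q, of A L M] error_update_riccati_gain[OF GH HH Y q]
    by simp
  finally show ?thesis
    using pos_def_imp_semidef[OF pos_def_innovation_cov[OF Y HH q]] le
    by (simp add: pos_semidef_add pos_semidef_congruence)
qed

section \<open>Random vectors and matrices\<close>

lemma nth_measurable: "f \<in> borel_measurable M \<Longrightarrow> (\<lambda>\<omega>. f \<omega> $ i :: real) \<in> borel_measurable M"
  by (erule borel_measurable_continuous_on[rotated]) (intro continuous_intros)

lemma integrable_matrixI:
  fixes f :: "'a \<Rightarrow> real ^ 'n ^ 'm"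
  assumes "\<And>i j. integrable M (\<lambda>\<omega>. f \<omega> $ i $ j)"
  shows "integrable M f"
proof -
  have "f \<omega> = (\<Sum>i\<in>UNIV. \<Sum>j\<in>UNIV. f \<omega> $ i $ j *\<^sub>R axis i (axis j 1))" for \<omega>
  proof -
    have "(\<Sum>j\<in>UNIV. f \<omega> $ i $ j *\<^sub>R axis i (axis j 1)) $ i' $ j'
        = (if i = i' then f \<omega> $ i' $ j' else 0)" for i i' j'
      by (auto simp: axis_def if_distrib[of "\<lambda>x. _ * x"] cong: if_cong)
    then show ?thesis by (simp add: vec_eq_iff)
  qed
  then have "f = (\<lambda>\<omega>. \<Sum>i\<in>UNIV. \<Sum>j\<in>UNIV. f \<omega> $ i $ j *\<^sub>R axis i (axis j 1))" by blast
  moreover have "integrable M \<dots>" using assms by (intro Bochner_Integration.integrable_sum) auto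
  ultimately show ?thesis by simp
qed

lemma matrix_integral_nth:
  fixes f :: "'a \<Rightarrow> real ^ 'n ^ 'm"
  assumes "integrable M f"
  shows "integrable M (\<lambda>\<omega>. f \<omega> $ i $ j)" "(\<integral>\<omega>. f \<omega> \<partial>M) $ i $ j = (\<integral>\<omega>. f \<omega> $ i $ j \<partial>M)"
proof -
  have b: "bounded_linear (\<lambda>X :: real ^ 'n ^ 'm. X $ i $ j)"
    by (intro bounded_linear_compose[OF bounded_linear_vec_nth] bounded_linear_vec_nth)
  show "integrable M (\<lambda>\<omega>. f \<omega> $ i $ j)"
    by (rule integrable_bounded_linear[OF b assms])
  show "(\<integral>\<omega>. f \<omega> \<partial>M) $ i $ j = (\<integral>\<omega>. f \<omega> $ i $ j \<partial>M)"
    by (rule integral_bounded_linear[OF b assms, symmetric])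
qed

lemma has_bochner_integral_matrixI:
  fixes f :: "'a \<Rightarrow> real ^ 'n ^ 'm"
  assumes "\<And>i j. has_bochner_integral M (\<lambda>\<omega>. f \<omega> $ i $ j) (V $ i $ j)"
  shows "has_bochner_integral M f V"
proof -
  have int: "integrable M f"
    by (rule integrable_matrixI) (use assms in \<open>auto simp: has_bochner_integral_iff\<close>)
  moreover have "(\<integral>\<omega>. f \<omega> \<partial>M) = V"
    using assms by (simp add: vec_eq_iff matrix_integral_nth[OF int] has_bochner_integral_iff)
  ultimately show ?thesis by (simp add: has_bochner_integral_iff)
qed

text \<open>Normality is a statement about linear functionals, so it gives the variance in every direction,
  including the degenerate ones. The entries of the covariance matrix follow by polarization, as
  \<open>4 u\<^sub>i u\<^sub>j = (u\<^sub>i + u\<^sub>j)\<^sup>2 - (u\<^sub>i - u\<^sub>j)\<^sup>2\<close>.\<close>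

lemma normal_vec_second_moment:
  fixes X :: "'w \<Rightarrow> real ^ 'n"
  assumes "prob_space P" and nv: "normal_vec P X \<mu> C"
  shows "has_bochner_integral P (\<lambda>\<omega>. outer (X \<omega> - \<mu>) (X \<omega> - \<mu>)) C"
proof -
  interpret prob_space P by fact
  have [measurable]: "X \<in> borel_measurable P" and sym: "transpose C = C"
    using nv by (auto simp: normal_vec_def pos_semidef_def)
  have dir: "has_bochner_integral P (\<lambda>\<omega>. (a \<bullet> (X \<omega> - \<mu>))\<^sup>2) (a \<bullet> (C *v a))" for a
  proof (cases "a \<bullet> (C *v a) = 0")
    case True
    then have "AE \<omega> in P. a \<bullet> X \<omega> = a \<bullet> \<mu>"
      using nv unfolding normal_vec_def by presburger
    then have "AE \<omega> in P. (a \<bullet> (X \<omega> - \<mu>))\<^sup>2 = 0"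
      by eventually_elim (simp add: inner_diff_right)
    then have "has_bochner_integral P (\<lambda>\<omega>. (a \<bullet> (X \<omega> - \<mu>))\<^sup>2) 0 \<longleftrightarrow>
        has_bochner_integral P (\<lambda>\<omega>. 0 :: real) 0"
      by (intro has_bochner_integral_cong_AE) auto
    then show ?thesis using True has_bochner_integral_zero by simp
  next
    case False
    define \<sigma> where "\<sigma> = sqrt (a \<bullet> (C *v a))"
    have pos: "0 < a \<bullet> (C *v a)"
      using False nv by (metis normal_vec_def pos_semidef_def order_le_less)
    then have \<sigma>: "0 < \<sigma>" "\<sigma>\<^sup>2 = a \<bullet> (C *v a)" by (auto simp: \<sigma>_def)
    have D: "distributed P lborel (\<lambda>\<omega>. a \<bullet> X \<omega>) (normal_density (a \<bullet> \<mu>) \<sigma>)"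
      using nv False unfolding normal_vec_def \<sigma>_def by presburger
    have "has_bochner_integral lborel (\<lambda>t. normal_density (a \<bullet> \<mu>) \<sigma> t * (t - a \<bullet> \<mu>)\<^sup>2) (\<sigma>\<^sup>2)"
      using normal_moment_even[OF \<sigma>(1), of "a \<bullet> \<mu>" 1] by (simp add: numeral_2_eq_2)
    moreover have "integrable lborel (\<lambda>t. normal_density (a \<bullet> \<mu>) \<sigma> t * (t - a \<bullet> \<mu>)\<^sup>2) \<longleftrightarrow>
        integrable P (\<lambda>\<omega>. (a \<bullet> X \<omega> - a \<bullet> \<mu>)\<^sup>2)"
      using distributed_integrable[OF D, of "\<lambda>t. (t - a \<bullet> \<mu>)\<^sup>2"] by simp
    moreover have "(\<integral>t. normal_density (a \<bullet> \<mu>) \<sigma> t * (t - a \<bullet> \<mu>)\<^sup>2 \<partial>lborel) =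
        (\<integral>\<omega>. (a \<bullet> X \<omega> - a \<bullet> \<mu>)\<^sup>2 \<partial>P)"
      using distributed_integral[OF D, of "\<lambda>t. (t - a \<bullet> \<mu>)\<^sup>2"] by simp
    ultimately show ?thesis
      by (simp add: has_bochner_integral_iff inner_diff_right \<sigma>)
  qed
  show ?thesis
  proof (rule has_bochner_integral_matrixI)
    fix i j
    let ?p = "axis i 1 + axis j 1 :: real ^ 'n" and ?m = "axis i 1 - axis j 1 :: real ^ 'n"
    have ax: "axis i' 1 \<bullet> (C *v axis j' 1) = C $ i' $ j'" for i' j'
      by (simp add: inner_axis' matrix_vector_mult_basis column_def)
    have sy: "C $ j $ i = C $ i $ j"
      using sym by (metis transpose_def vec_lambda_beta)
    have "has_bochner_integral P
        (\<lambda>\<omega>. ((?p \<bullet> (X \<omega> - \<mu>))\<^sup>2 - (?m \<bullet> (X \<omega> - \<mu>))\<^sup>2) / 4)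
        ((?p \<bullet> (C *v ?p) - ?m \<bullet> (C *v ?m)) / 4)"
      by (intro has_bochner_integral_divide_zero has_bochner_integral_diff dir)
    moreover have "((?p \<bullet> (X \<omega> - \<mu>))\<^sup>2 - (?m \<bullet> (X \<omega> - \<mu>))\<^sup>2) / 4
        = outer (X \<omega> - \<mu>) (X \<omega> - \<mu>) $ i $ j" for \<omega>
      by (simp add: outer_def inner_add_left inner_diff_left inner_axis' power2_eq_square field_simps)
    moreover have "(?p \<bullet> (C *v ?p) - ?m \<bullet> (C *v ?m)) / 4 = C $ i $ j"
      by (simp add: inner_add_left inner_diff_left matrix_vector_right_distrib
          matrix_vector_mult_diff_distrib inner_add_right inner_diff_right ax sy)
    ultimately show "has_bochner_integral P (\<lambda>\<omega>. outer (X \<omega> - \<mu>) (X \<omega> - \<mu>) $ i $ j) (C $ i $ j)"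
      by simp
  qed
qed

text \<open>Conditional expectations are ordered as soon as the integrals over all sets of the conditioning
  sigma-algebra are; the integrands themselves need not be comparable. It suffices to test the set
  on which the order fails.\<close>

lemma real_cond_exp_mono_set_integral:
  assumes "finite_measure_subalgebra P F"
    and f: "integrable P f" and g: "integrable P g"
    and le: "\<And>B. B \<in> sets F \<Longrightarrow> (\<integral>\<omega>\<in>B. f \<omega> \<partial>P) \<le> (\<integral>\<omega>\<in>B. g \<omega> \<partial>P)"
  shows "AE \<omega> in P. real_cond_exp P F f \<omega> \<le> real_cond_exp P F g \<omega>"
proof -
  interpret finite_measure_subalgebra P F by fact
  let ?d = "\<lambda>\<omega>. real_cond_exp P F f \<omega> - real_cond_exp P F g \<omega>"
  define B where "B = {\<omega> \<in> space F. 0 < ?d \<omega>}"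
  have B: "B \<in> sets F" unfolding B_def by measurable
  then have BP: "B \<in> sets P" using subalg by (auto simp: subalgebra_def)
  have sp: "space F = space P" using subalg by (simp add: subalgebra_def)
  note F = real_cond_exp_int(1)[OF f] and G = real_cond_exp_int(1)[OF g]
  have int: "integrable P (\<lambda>\<omega>. indicator B \<omega> * ?d \<omega>)"
    using integrable_mult_indicator[OF BP Bochner_Integration.integrable_diff[OF F G]] by simp
  have "(\<integral>\<omega>. indicator B \<omega> * ?d \<omega> \<partial>P) =
      (\<integral>\<omega>\<in>B. real_cond_exp P F f \<omega> \<partial>P) - (\<integral>\<omega>\<in>B. real_cond_exp P F g \<omega> \<partial>P)"
    using integrable_mult_indicator[OF BP F] integrable_mult_indicator[OF BP G]
    by (simp add: set_lebesgue_integral_def right_diff_distrib)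
  also have "\<dots> \<le> 0"
    using le[OF B] real_cond_exp_intA[OF f B] real_cond_exp_intA[OF g B] by simp
  moreover have nonneg: "0 \<le> indicator B \<omega> * ?d \<omega>" for \<omega>
    by (auto simp: B_def indicator_def)
  ultimately have "(\<integral>\<omega>. indicator B \<omega> * ?d \<omega> \<partial>P) = 0"
    by (intro antisym integral_nonneg_AE) auto
  then have "AE \<omega> in P. indicator B \<omega> * ?d \<omega> = 0"
    using integral_nonneg_eq_0_iff_AE[OF int] nonneg by simp
  then show ?thesis
    using AE_space by eventually_elim (auto simp: B_def indicator_def sp split: if_splits)
qed

lemma sigma_of_subset: "f \<in> P \<rightarrow>\<^sub>M D \<Longrightarrow> sigma_of P D f \<subseteq> sets P"
  by (auto simp: sigma_of_def intro: measurable_sets)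

text \<open>The library notion of independent random variables requires both to have the same type. This
  form passes from independence of the generated sigma-algebras, of variables of any type, to
  independence of real functions of them.\<close>

lemma (in prob_space) indep_var_compose_sigma_of:
  fixes g :: "'b \<Rightarrow> real" and \<phi> :: "'c \<Rightarrow> real"
  assumes indep: "indep_set (sigma_of M B X) (sigma_of M C Y)"
    and X: "X \<in> M \<rightarrow>\<^sub>M B" and Y: "Y \<in> M \<rightarrow>\<^sub>M C"
    and g: "g \<in> borel_measurable B" and \<phi>: "\<phi> \<in> borel_measurable C"
  shows "indep_var borel (g \<circ> X) borel (\<phi> \<circ> Y)"
proof -
  have sub: "sigma_of M borel (f \<circ> Z) \<subseteq> sigma_of M D Z"
    if "f \<in> borel_measurable D" "Z \<in> M \<rightarrow>\<^sub>M D" for f :: "'x \<Rightarrow> real" and D Z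
  proof
    fix S assume "S \<in> sigma_of M borel (f \<circ> Z)"
    then obtain E where E: "E \<in> sets borel" "S = (f \<circ> Z) -` E \<inter> space M"
      by (auto simp: sigma_of_def)
    have "S = Z -` (f -` E \<inter> space D) \<inter> space M"
      using that(2) by (auto simp: E(2) measurable_def)
    moreover have "f -` E \<inter> space D \<in> sets D"
      using that(1) E(1) by (rule measurable_sets)
    ultimately show "S \<in> sigma_of M D Z" unfolding sigma_of_def by blast
  qed
  have gen: "sigma_sets (space M) (sigma_of M borel Z) = sigma_of M borel Z"
    if "Z \<in> borel_measurable M" for Z :: "'a \<Rightarrow> real"
  proof -
    have "sigma_of M borel Z = sets (vimage_algebra (space M) Z borel)"
      by (subst sets_vimage_algebra2) (auto simp: sigma_of_def)
    then show ?thesis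
      using sets.sigma_sets_eq[of "vimage_algebra (space M) Z borel"] by simp
  qed
  have gX: "g \<circ> X \<in> borel_measurable M" and \<phi>Y: "\<phi> \<circ> Y \<in> borel_measurable M"
    using X Y g \<phi> by (auto intro: measurable_comp)
  have "indep_set (sigma_of M borel (g \<circ> X)) (sigma_of M borel (\<phi> \<circ> Y))"
    using indep sub[OF g X] sub[OF \<phi> Y] unfolding indep_sets2_eq by (meson subset_iff)
  then show ?thesis
    using gX \<phi>Y by (simp add: indep_var_eq gen flip: sigma_of_def)
qed

lemma (in prob_space) indep_var_has_bochner_integral_mult:
  fixes X Y :: "'a \<Rightarrow> real"
  assumes "indep_var borel X borel Y" "has_bochner_integral M X a" "has_bochner_integral M Y b"
  shows "has_bochner_integral M (\<lambda>\<omega>. X \<omega> * Y \<omega>) (a * b)"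
  using indep_var_integrable[OF assms(1)] indep_var_lebesgue_integral[OF assms(1)] assms
  by (auto simp: has_bochner_integral_iff)

section \<open>Linear recursions driven by white noise\<close>

primrec lin_err ::
  "('w \<Rightarrow> real ^ 'n) \<Rightarrow> (nat \<Rightarrow> 'w \<Rightarrow> real ^ 'r) \<Rightarrow> (nat \<Rightarrow> real ^ 'n ^ 'n) \<Rightarrow> (nat \<Rightarrow> real ^ 'r ^ 'n)
    \<Rightarrow> nat \<Rightarrow> 'w \<Rightarrow> real ^ 'n" where
  "lin_err e0 w F E 0 = e0"
| "lin_err e0 w F E (Suc k) = (\<lambda>\<omega>. F k *v lin_err e0 w F E k \<omega> + E k *v w k \<omega>)"

primrec lin_cov ::
  "real ^ 'n ^ 'n \<Rightarrow> (nat \<Rightarrow> real ^ 'n ^ 'n) \<Rightarrow> (nat \<Rightarrow> real ^ 'r ^ 'n) \<Rightarrow> nat \<Rightarrow> real ^ 'n ^ 'n" where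
  "lin_cov \<Psi> F E 0 = \<Psi>"
| "lin_cov \<Psi> F E (Suc k) = F k ** lin_cov \<Psi> F E k ** transpose (F k) + E k ** transpose (E k)"

lemma pos_semidef_lin_cov: "pos_semidef \<Psi> \<Longrightarrow> pos_semidef (lin_cov \<Psi> F E k)"
  by (induction k) (auto intro!: pos_semidef_add pos_semidef_congruence pos_semidef_gram)

text \<open>The weight \<open>b\<close> will be the indicator of an event of probability \<open>\<beta>\<close>. The error at time \<open>k\<close> is a linear
  combination of the initial error and of the noise before \<open>k\<close>, hence uncorrelated with the noise
  from \<open>k\<close> on. This second fact is carried through the induction, and it removes the mixed terms
  from the second moment.\<close>

lemma lin_err_moments:
  fixes b :: "'w \<Rightarrow> real" and w :: "nat \<Rightarrow> 'w \<Rightarrow> real ^ 'r" and e0 :: "'w \<Rightarrow> real ^ 'n"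
  assumes e0: "has_bochner_integral P (\<lambda>\<omega>. b \<omega> *\<^sub>R outer (e0 \<omega>) (e0 \<omega>)) (\<beta> *\<^sub>R \<Psi>)"
    and e0w: "\<And>m. has_bochner_integral P (\<lambda>\<omega>. b \<omega> *\<^sub>R outer (e0 \<omega>) (w m \<omega>)) 0"
    and w: "\<And>m. has_bochner_integral P (\<lambda>\<omega>. b \<omega> *\<^sub>R outer (w m \<omega>) (w m \<omega>)) (\<beta> *\<^sub>R mat 1)"
    and ww: "\<And>m m'. m \<noteq> m' \<Longrightarrow> has_bochner_integral P (\<lambda>\<omega>. b \<omega> *\<^sub>R outer (w m \<omega>) (w m' \<omega>)) 0"
  shows "has_bochner_integral P
      (\<lambda>\<omega>. b \<omega> *\<^sub>R outer (lin_err e0 w F E k \<omega>) (lin_err e0 w F E k \<omega>)) (\<beta> *\<^sub>R lin_cov \<Psi> F E k)"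
proof -
  let ?e = "lin_err e0 w F E"
  have "(\<forall>m\<ge>k. has_bochner_integral P (\<lambda>\<omega>. b \<omega> *\<^sub>R outer (?e k \<omega>) (w m \<omega>)) 0) \<and>
    has_bochner_integral P (\<lambda>\<omega>. b \<omega> *\<^sub>R outer (?e k \<omega>) (?e k \<omega>)) (\<beta> *\<^sub>R lin_cov \<Psi> F E k)"
  proof (induction k)
    case 0
    then show ?case using e0 e0w by simp
  next
    case (Suc k)
    then have ew: "has_bochner_integral P (\<lambda>\<omega>. b \<omega> *\<^sub>R outer (?e k \<omega>) (w m \<omega>)) 0" if "k \<le> m" for m
      using that by blast
    have ee: "has_bochner_integral P (\<lambda>\<omega>. b \<omega> *\<^sub>R outer (?e k \<omega>) (?e k \<omega>)) (\<beta> *\<^sub>R lin_cov \<Psi> F E k)"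
      using Suc by blast
    have we: "has_bochner_integral P (\<lambda>\<omega>. b \<omega> *\<^sub>R outer (w k \<omega>) (?e k \<omega>)) 0"
      using has_bochner_integral_bounded_linear[OF transpose_bounded_linear ew[OF order_refl]]
      by (simp add: transpose_scalar outer_simps transpose_zero)
    have cg: "has_bochner_integral P (\<lambda>\<omega>. b \<omega> *\<^sub>R (C ** f \<omega> ** D)) (C ** V ** D)"
      if "has_bochner_integral P (\<lambda>\<omega>. b \<omega> *\<^sub>R f \<omega>) V"
      for C :: "real ^ 'b ^ 'a" and D :: "real ^ 'd ^ 'c" and f V
      using has_bochner_integral_bounded_linear[OF congruence_bounded_linear that, of C D]
      by (simp add: matrix_ring_simps)
    have "has_bochner_integral P (\<lambda>\<omega>. b \<omega> *\<^sub>R outer (?e (Suc k) \<omega>) (w m \<omega>)) 0" if "Suc k \<le> m" for m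
    proof -
      have "has_bochner_integral P (\<lambda>\<omega>. b \<omega> *\<^sub>R (F k ** outer (?e k \<omega>) (w m \<omega>) ** mat 1)
          + b \<omega> *\<^sub>R (E k ** outer (w k \<omega>) (w m \<omega>) ** mat 1))
          (F k ** 0 ** mat 1 + E k ** 0 ** mat 1)"
        using that by (intro has_bochner_integral_add cg ew ww) auto
      then show ?thesis by (simp add: outer_simps matrix_ring_simps scaleR_add_right)
    qed
    moreover have "has_bochner_integral P (\<lambda>\<omega>.
        (b \<omega> *\<^sub>R (F k ** outer (?e k \<omega>) (?e k \<omega>) ** transpose (F k))
         + b \<omega> *\<^sub>R (E k ** outer (w k \<omega>) (w k \<omega>) ** transpose (E k)))
        + (b \<omega> *\<^sub>R (F k ** outer (?e k \<omega>) (w k \<omega>) ** transpose (E k))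
         + b \<omega> *\<^sub>R (E k ** outer (w k \<omega>) (?e k \<omega>) ** transpose (F k))))
        ((F k ** (\<beta> *\<^sub>R lin_cov \<Psi> F E k) ** transpose (F k)
          + E k ** (\<beta> *\<^sub>R mat 1) ** transpose (E k))
         + (F k ** 0 ** transpose (E k) + E k ** 0 ** transpose (F k)))"
      by (intro has_bochner_integral_add cg ee ew we w order_refl)
    ultimately show ?case
      by (simp add: outer_simps matrix_ring_simps scaleR_add_right algebra_simps)
  qed
  then show ?thesis by blast
qed

section \<open>Moments along a mode path\<close>

locale markov_jump_system = prob_space P for P :: "'w measure" +
  fixes N :: nat and \<theta> :: "nat \<Rightarrow> 'w \<Rightarrow> nat"
    and p :: "nat \<Rightarrow> nat \<Rightarrow> real" and \<pi>0 :: "nat \<Rightarrow> real"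
    and A :: "nat \<Rightarrow> real ^ 'n ^ 'n" and G :: "nat \<Rightarrow> real ^ 'r ^ 'n"
    and L :: "nat \<Rightarrow> real ^ 'n ^ 'q" and H :: "nat \<Rightarrow> real ^ 'r ^ 'q"
    and x0 :: "'w \<Rightarrow> real ^ 'n" and xbar :: "real ^ 'n" and \<Psi> :: "real ^ 'n ^ 'n"
    and w :: "nat \<Rightarrow> 'w \<Rightarrow> real ^ 'r"
    and x :: "nat \<Rightarrow> 'w \<Rightarrow> real ^ 'n" and y :: "nat \<Rightarrow> 'w \<Rightarrow> real ^ 'q"
  assumes chain: "markov_chain P N \<theta> p \<pi>0"
    and x0_normal: "normal_vec P x0 xbar \<Psi>"
    and w_measurable[measurable]: "\<And>k. w k \<in> borel_measurable P"
    and w_mean: "\<And>k. (\<integral>\<omega>. w k \<omega> \<partial>P) = 0"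
    and w_cov: "\<And>k. (\<integral>\<omega>. outer (w k \<omega>) (w k \<omega>) \<partial>P) = mat 1"
    and w_uncorrelated: "\<And>k m. k \<noteq> m \<Longrightarrow> (\<integral>\<omega>. outer (w k \<omega>) (w m \<omega>) \<partial>P) = 0"
    and w_indep: "indep_set
           (sigma_of P (\<Pi>\<^sub>M k\<in>UNIV. borel) (\<lambda>\<omega> k. w k \<omega>))
           (sigma_of P (borel \<Otimes>\<^sub>M (\<Pi>\<^sub>M k\<in>UNIV. count_space UNIV)) (\<lambda>\<omega>. (x0 \<omega>, \<lambda>k. \<theta> k \<omega>)))"
    and x0_indep: "indep_set (sigma_of P borel x0)
           (sigma_of P (\<Pi>\<^sub>M k\<in>UNIV. count_space UNIV) (\<lambda>\<omega> k. \<theta> k \<omega>))"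
    and x_0: "\<And>\<omega>. x 0 \<omega> = x0 \<omega>"
    and x_Suc: "\<And>k \<omega>. x (Suc k) \<omega> = A (\<theta> k \<omega>) *v x k \<omega> + G (\<theta> k \<omega>) *v w k \<omega>"
    and y_eq: "\<And>k \<omega>. y k \<omega> = L (\<theta> k \<omega>) *v x k \<omega> + H (\<theta> k \<omega>) *v w k \<omega>"
begin

lemma theta_measurable[measurable]: "\<theta> k \<in> P \<rightarrow>\<^sub>M count_space UNIV"
  using chain by (simp add: markov_chain_def)

lemma theta_range: "\<omega> \<in> space P \<Longrightarrow> \<theta> k \<omega> \<in> {1..N}"
  using chain by (simp add: markov_chain_def)

lemma x0_measurable[measurable]: "x0 \<in> borel_measurable P"
  using x0_normal by (simp add: normal_vec_def)

lemma matrix_vector_measurable: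
  fixes B :: "nat \<Rightarrow> real ^ 'a ^ 'b"
  assumes "f \<in> borel_measurable P"
  shows "(\<lambda>\<omega>. B (\<theta> k \<omega>) *v f \<omega>) \<in> borel_measurable P"
proof (rule measurable_compose_countable[where g="\<theta> k" and f="\<lambda>i \<omega>. B i *v f \<omega>"])
  show "(\<lambda>\<omega>. B i *v f \<omega>) \<in> borel_measurable P" for i
    by (intro borel_measurable_continuous_on[OF _ assms] continuous_intros)
qed measurable

lemma x_measurable[measurable]: "x k \<in> borel_measurable P"
proof (induction k)
  case 0
  have "x 0 = x0" by (simp add: fun_eq_iff x_0)
  then show ?case by simp
next
  case (Suc k)
  have "x (Suc k) = (\<lambda>\<omega>. A (\<theta> k \<omega>) *v x k \<omega> + G (\<theta> k \<omega>) *v w k \<omega>)"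
    by (simp add: fun_eq_iff x_Suc)
  then show ?case by (simp add: borel_measurable_add matrix_vector_measurable Suc)
qed

lemma y_measurable[measurable]: "y k \<in> borel_measurable P"
proof -
  have "y k = (\<lambda>\<omega>. L (\<theta> k \<omega>) *v x k \<omega> + H (\<theta> k \<omega>) *v w k \<omega>)"
    by (simp add: fun_eq_iff y_eq)
  then show ?thesis by (simp add: borel_measurable_add matrix_vector_measurable)
qed

definition path_set :: "(nat \<Rightarrow> nat) \<Rightarrow> nat \<Rightarrow> 'w set" where
  "path_set a k = {\<omega> \<in> space P. \<forall>m\<le>k. \<theta> m \<omega> = a m}"

lemma path_set_measurable[measurable]: "path_set a k \<in> sets P"
  unfolding path_set_def by measurable

text \<open>If the path up to \<open>k\<close> has probability zero, the Markov property says nothing, but then both sides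
  vanish.\<close>

lemma prob_path_set_step:
  assumes "i \<in> {1..N}"
  shows "prob (path_set (a(Suc k := i)) (Suc k)) = p (a k) i * prob (path_set a k)"
proof -
  have eq: "path_set (a(Suc k := i)) (Suc k) = {\<omega> \<in> space P. \<theta> (Suc k) \<omega> = i \<and> (\<forall>m\<le>k. \<theta> m \<omega> = a m)}"
    by (auto simp: path_set_def le_Suc_eq)
  show ?thesis
  proof (cases "prob (path_set a k) = 0")
    case True
    have "prob (path_set (a(Suc k := i)) (Suc k)) \<le> prob (path_set a k)"
      by (rule finite_measure_mono) (auto simp: eq path_set_def)
    then show ?thesis using True by (simp add: measure_le_0_iff)
  next
    case False
    have step: "\<forall>k a. \<forall>i\<in>{1..N}. \<P>(\<omega> in P. \<forall>m\<le>k. \<theta> m \<omega> = a m) \<noteq> 0 \<longrightarrow>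
        \<P>(\<omega> in P. \<theta> (Suc k) \<omega> = i \<bar> \<forall>m\<le>k. \<theta> m \<omega> = a m) = p (a k) i"
      using chain unfolding markov_chain_def by (elim conjE)
    have "\<P>(\<omega> in P. \<theta> (Suc k) \<omega> = i \<bar> \<forall>m\<le>k. \<theta> m \<omega> = a m) = p (a k) i"
      by (rule step[rule_format, OF assms]) (use False in \<open>simp add: path_set_def\<close>)
    then show ?thesis
      unfolding eq using False by (simp add: cond_prob_def path_set_def field_simps)
  qed
qed

lemma mode_sequence_measurable[measurable]:
  "(\<lambda>\<omega> k. \<theta> k \<omega>) \<in> P \<rightarrow>\<^sub>M (\<Pi>\<^sub>M k\<in>UNIV. count_space UNIV)"
  by (auto intro!: measurable_PiM_single')

lemma noise_sequence_measurable[measurable]: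
  "(\<lambda>\<omega> k. w k \<omega>) \<in> P \<rightarrow>\<^sub>M (\<Pi>\<^sub>M k\<in>UNIV. borel)"
  by (auto intro!: measurable_PiM_single')

text \<open>Integrability of the squares is implicit in the covariance condition: the integral of a
  function that is not integrable is \<open>0\<close>, which is not the identity matrix.\<close>

lemma w_second_moment: "has_bochner_integral P (\<lambda>\<omega>. outer (w k \<omega>) (w k \<omega>)) (mat 1)"
proof -
  have "integrable P (\<lambda>\<omega>. outer (w k \<omega>) (w k \<omega>))"
  proof (rule ccontr)
    assume "\<not> integrable P (\<lambda>\<omega>. outer (w k \<omega>) (w k \<omega>))"
    then have "mat 1 = (0 :: real ^ 'r ^ 'r)"
      using w_cov[of k] by (simp add: not_integrable_integral_eq)
    then show False by (simp add: mat_def vec_eq_iff) (metis one_neq_zero)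
  qed
  then show ?thesis by (simp add: has_bochner_integral_iff w_cov)
qed

lemma w_square_integrable: "integrable P (\<lambda>\<omega>. (w k \<omega> $ i)\<^sup>2)"
  using matrix_integral_nth(1)[of P "\<lambda>\<omega>. outer (w k \<omega>) (w k \<omega>)" i i] w_second_moment[of k]
  by (simp add: has_bochner_integral_iff outer_def power2_eq_square)

lemma w_mean_nth: "has_bochner_integral P (\<lambda>\<omega>. w k \<omega> $ i) 0"
proof -
  have "integrable P (\<lambda>\<omega>. w k \<omega> $ i)" for i
    by (rule square_integrable_imp_integrable[OF nth_measurable[OF w_measurable] w_square_integrable])
  moreover have "integrable P (w k)"
  proof -
    have "integrable P (\<lambda>\<omega>. \<Sum>i\<in>UNIV. (w k \<omega> $ i) *\<^sub>R (axis i 1 :: real ^ 'r))"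
      using calculation by (intro Bochner_Integration.integrable_sum) auto
    moreover have "(\<Sum>i\<in>UNIV. (v $ i) *\<^sub>R axis i 1) = v" for v :: "real ^ 'r"
      by (simp add: vec_eq_iff axis_def if_distrib[of "\<lambda>x. _ * x"] cong: if_cong)
    ultimately show ?thesis by (simp only:)
  qed
  then have "(\<integral>\<omega>. w k \<omega> $ i \<partial>P) = (\<integral>\<omega>. w k \<omega> \<partial>P) $ i"
    by (rule integral_bounded_linear[OF bounded_linear_vec_nth])
  ultimately show ?thesis by (simp add: has_bochner_integral_iff w_mean)
qed

text \<open>Here the value \<open>0\<close> of the integral does not imply integrability; it comes from
  \<open>\<bar>u v\<bar> \<le> u\<^sup>2 + v\<^sup>2\<close>.\<close>

lemma w_cross_moment:
  assumes "k \<noteq> m" shows "has_bochner_integral P (\<lambda>\<omega>. outer (w k \<omega>) (w m \<omega>)) 0"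
proof -
  have "integrable P (\<lambda>\<omega>. w k \<omega> $ i * w m \<omega> $ j)" for i j
  proof (rule Bochner_Integration.integrable_bound)
    show "integrable P (\<lambda>\<omega>. (w k \<omega> $ i)\<^sup>2 + (w m \<omega> $ j)\<^sup>2)"
      by (intro Bochner_Integration.integrable_add w_square_integrable)
    show "(\<lambda>\<omega>. w k \<omega> $ i * w m \<omega> $ j) \<in> borel_measurable P"
      by (intro borel_measurable_times nth_measurable w_measurable)
    have "\<bar>u * v\<bar> \<le> u\<^sup>2 + v\<^sup>2" for u v :: real
    proof -
      have "2 * (\<bar>u\<bar> * \<bar>v\<bar>) \<le> u\<^sup>2 + v\<^sup>2"
        using sum_squares_bound[of "\<bar>u\<bar>" "\<bar>v\<bar>"] by (simp add: mult.assoc)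
      moreover have "0 \<le> \<bar>u\<bar> * \<bar>v\<bar>" by simp
      ultimately show ?thesis unfolding abs_mult by linarith
    qed
    then show "AE \<omega> in P. norm (w k \<omega> $ i * w m \<omega> $ j) \<le> norm ((w k \<omega> $ i)\<^sup>2 + (w m \<omega> $ j)\<^sup>2)"
      by simp
  qed
  then have "integrable P (\<lambda>\<omega>. outer (w k \<omega>) (w m \<omega>))"
    by (intro integrable_matrixI) (simp add: outer_def)
  then show ?thesis using w_uncorrelated[OF assms] by (simp add: has_bochner_integral_iff)
qed

text \<open>The indicator of a mode path as a function of the mode sequence, the form in which
  independence applies to it.\<close>

abbreviation path_ind :: "(nat \<Rightarrow> nat) \<Rightarrow> nat \<Rightarrow> (nat \<Rightarrow> nat) \<Rightarrow> real" where
  "path_ind a n t \<equiv> of_bool (\<forall>m\<le>n. t m = a m)"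

lemma path_ind_measurable:
  "path_ind a n \<in> borel_measurable (\<Pi>\<^sub>M k\<in>UNIV. count_space UNIV)"
proof -
  have [measurable]: "(\<lambda>t. t m) \<in> (\<Pi>\<^sub>M k\<in>UNIV. count_space (UNIV :: nat set)) \<rightarrow>\<^sub>M count_space UNIV" for m :: nat
    by (rule measurable_component_singleton) simp
  show ?thesis by measurable
qed

lemma path_ind_eq: "\<omega> \<in> space P \<Longrightarrow> path_ind a n (\<lambda>k. \<theta> k \<omega>) = indicator (path_set a n) \<omega>"
  by (simp add: path_set_def indicator_def)

lemma path_ind_integral:
  "has_bochner_integral P (\<lambda>\<omega>. path_ind a n (\<lambda>k. \<theta> k \<omega>)) (prob (path_set a n))"
  by (subst has_bochner_integral_cong[OF refl path_ind_eq refl])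
    (auto intro!: has_bochner_integral_real_indicator simp: less_top[symmetric])

lemma initial_moment_on_path:
  "has_bochner_integral P (\<lambda>\<omega>. indicator (path_set a n) \<omega> *\<^sub>R outer (x0 \<omega> - xbar) (x0 \<omega> - xbar))
     (prob (path_set a n) *\<^sub>R \<Psi>)"
proof (rule has_bochner_integral_matrixI)
  fix i j
  define g where "g v = outer (v - xbar) (v - xbar) $ i $ j" for v
  have int: "has_bochner_integral P (g \<circ> x0) (\<Psi> $ i $ j)"
    using normal_vec_second_moment[OF prob_space_axioms x0_normal]
    by (auto simp: has_bochner_integral_iff matrix_integral_nth g_def o_def)
  have "g \<in> borel_measurable borel"
    unfolding g_def outer_def vec_lambda_beta
    by (rule borel_measurable_times[OF nth_measurable nth_measurable]) measurable
  from indep_var_compose_sigma_of[OF x0_indep x0_measurable mode_sequence_measurable this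
      path_ind_measurable]
  have "has_bochner_integral P (\<lambda>\<omega>. (g \<circ> x0) \<omega> * (path_ind a n \<circ> (\<lambda>\<omega> k. \<theta> k \<omega>)) \<omega>)
      (\<Psi> $ i $ j * prob (path_set a n))"
    by (rule indep_var_has_bochner_integral_mult[OF _ int]) (simp add: o_def path_ind_integral)
  then show "has_bochner_integral P (\<lambda>\<omega>. (indicator (path_set a n) \<omega> *\<^sub>R
      outer (x0 \<omega> - xbar) (x0 \<omega> - xbar)) $ i $ j) ((prob (path_set a n) *\<^sub>R \<Psi>) $ i $ j)"
    by (rule has_bochner_integral_cong[OF refl _ _, THEN iffD1, rotated 2])
      (auto simp: g_def path_ind_eq)
qed

lemma noise_factor:
  assumes \<phi>: "\<phi> \<in> borel_measurable (borel \<Otimes>\<^sub>M (\<Pi>\<^sub>M k\<in>UNIV. count_space UNIV))"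
    and g: "g \<in> borel_measurable (\<Pi>\<^sub>M k\<in>UNIV. borel)"
    and "has_bochner_integral P (\<lambda>\<omega>. \<phi> (x0 \<omega>, \<lambda>k. \<theta> k \<omega>)) \<alpha>"
    and "has_bochner_integral P (\<lambda>\<omega>. g (\<lambda>k. w k \<omega>)) \<gamma>"
  shows "has_bochner_integral P (\<lambda>\<omega>. \<phi> (x0 \<omega>, \<lambda>k. \<theta> k \<omega>) * g (\<lambda>k. w k \<omega>)) (\<alpha> * \<gamma> :: real)"
proof -
  have "(\<lambda>\<omega>. (x0 \<omega>, \<lambda>k. \<theta> k \<omega>)) \<in> P \<rightarrow>\<^sub>M borel \<Otimes>\<^sub>M (\<Pi>\<^sub>M k\<in>UNIV. count_space UNIV)"
    by measurable
  from indep_var_compose_sigma_of[OF w_indep noise_sequence_measurable this g \<phi>]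
  have "has_bochner_integral P (\<lambda>\<omega>. (g \<circ> (\<lambda>\<omega> k. w k \<omega>)) \<omega> * (\<phi> \<circ> (\<lambda>\<omega>. (x0 \<omega>, \<lambda>k. \<theta> k \<omega>))) \<omega>)
      (\<gamma> * \<alpha>)"
    by (rule indep_var_has_bochner_integral_mult) (use assms(3,4) in \<open>simp_all add: o_def\<close>)
  then show ?thesis by (simp add: mult.commute)
qed

lemma noise_nth_measurable:
  "(\<lambda>v. v m $ i) \<in> borel_measurable (\<Pi>\<^sub>M k\<in>UNIV. (borel :: (real ^ 'r) measure))" for m :: nat
  by (intro nth_measurable measurable_component_singleton) simp

lemma noise_moment_on_path:
  assumes int: "has_bochner_integral P (\<lambda>\<omega>. outer (w m \<omega>) (w m' \<omega>)) V"
  shows "has_bochner_integral P (\<lambda>\<omega>. indicator (path_set a n) \<omega> *\<^sub>R outer (w m \<omega>) (w m' \<omega>))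
     (prob (path_set a n) *\<^sub>R V)"
proof (rule has_bochner_integral_matrixI)
  fix i j
  have "has_bochner_integral P (\<lambda>\<omega>. (path_ind a n \<circ> snd) (x0 \<omega>, \<lambda>k. \<theta> k \<omega>)
      * (\<lambda>v. v m $ i * v m' $ j) (\<lambda>k. w k \<omega>)) (prob (path_set a n) * V $ i $ j)"
  proof (rule noise_factor)
    show "path_ind a n \<circ> snd \<in> borel_measurable (borel \<Otimes>\<^sub>M (\<Pi>\<^sub>M k\<in>UNIV. count_space UNIV))"
      by (rule measurable_comp[OF measurable_snd path_ind_measurable])
    show "(\<lambda>v. v m $ i * v m' $ j :: real) \<in> borel_measurable (\<Pi>\<^sub>M k\<in>UNIV. borel)"
      by (rule borel_measurable_times[OF noise_nth_measurable noise_nth_measurable])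
    show "has_bochner_integral P (\<lambda>\<omega>. (path_ind a n \<circ> snd) (x0 \<omega>, \<lambda>k. \<theta> k \<omega>)) (prob (path_set a n))"
      using path_ind_integral[of n a] by simp
    show "has_bochner_integral P (\<lambda>\<omega>. w m \<omega> $ i * w m' \<omega> $ j) (V $ i $ j)"
      using int matrix_integral_nth[of P "\<lambda>\<omega>. outer (w m \<omega>) (w m' \<omega>)" i j]
      by (simp add: has_bochner_integral_iff outer_def)
  qed
  then show "has_bochner_integral P (\<lambda>\<omega>. (indicator (path_set a n) \<omega> *\<^sub>R
      outer (w m \<omega>) (w m' \<omega>)) $ i $ j) ((prob (path_set a n) *\<^sub>R V) $ i $ j)"
    by (rule has_bochner_integral_cong[OF refl _ _, THEN iffD1, rotated 2])
      (auto simp: outer_def path_ind_eq)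
qed

text \<open>The noise factor has mean zero, so the other factor only needs to be integrable.\<close>

lemma initial_noise_moment_on_path:
  "has_bochner_integral P (\<lambda>\<omega>. indicator (path_set a n) \<omega> *\<^sub>R outer (x0 \<omega> - xbar) (w m \<omega>)) 0"
proof (rule has_bochner_integral_matrixI)
  fix i j
  let ?g = "\<lambda>z. path_ind a n (snd z) * (fst z - xbar) $ i"
  have "integrable P (\<lambda>\<omega>. ((x0 \<omega> - xbar) $ i)\<^sup>2)"
    using normal_vec_second_moment[OF prob_space_axioms x0_normal]
      matrix_integral_nth(1)[of P "\<lambda>\<omega>. outer (x0 \<omega> - xbar) (x0 \<omega> - xbar)" i i]
    by (simp add: has_bochner_integral_iff) (simp add: outer_def power2_eq_square)
  then have "integrable P (\<lambda>\<omega>. (x0 \<omega> - xbar) $ i)"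
    by (rule square_integrable_imp_integrable[OF nth_measurable, rotated]) measurable
  then have "integrable P (\<lambda>\<omega>. indicator (path_set a n) \<omega> *\<^sub>R (x0 \<omega> - xbar) $ i)"
    by (rule integrable_mult_indicator[OF path_set_measurable])
  then have int: "integrable P (\<lambda>\<omega>. ?g (x0 \<omega>, \<lambda>k. \<theta> k \<omega>))"
    by (rule Bochner_Integration.integrable_cong[OF refl, THEN iffD1, rotated]) (simp add: path_ind_eq)
  have "has_bochner_integral P (\<lambda>\<omega>. ?g (x0 \<omega>, \<lambda>k. \<theta> k \<omega>) * (\<lambda>v. v m $ j) (\<lambda>k. w k \<omega>))
     ((\<integral>\<omega>. ?g (x0 \<omega>, \<lambda>k. \<theta> k \<omega>) \<partial>P) * 0)"
  proof (rule noise_factor)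
    show "?g \<in> borel_measurable (borel \<Otimes>\<^sub>M (\<Pi>\<^sub>M k\<in>UNIV. count_space UNIV))"
      by (intro borel_measurable_times nth_measurable borel_measurable_diff
          measurable_compose[OF measurable_snd path_ind_measurable] measurable_fst) simp
    show "has_bochner_integral P (\<lambda>\<omega>. ?g (x0 \<omega>, \<lambda>k. \<theta> k \<omega>))
        (\<integral>\<omega>. ?g (x0 \<omega>, \<lambda>k. \<theta> k \<omega>) \<partial>P)"
      using int by (rule has_bochner_integral_integrable)
  qed (rule noise_nth_measurable w_mean_nth)+
  then show "has_bochner_integral P (\<lambda>\<omega>. (indicator (path_set a n) \<omega> *\<^sub>R
      outer (x0 \<omega> - xbar) (w m \<omega>)) $ i $ j) (0 $ i $ j)"
    by (rule has_bochner_integral_cong[OF refl _ _, THEN iffD1, rotated 2])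
      (auto simp: outer_def path_ind_eq)
qed

text \<open>The path \<open>a\<close> and the coefficients \<open>F\<close>, \<open>E\<close> are unrelated here: the path event matters only through its
  independence of the initial state and of the noise, which makes its probability a common factor
  of all moments.\<close>

lemma lin_err_moment_on_path:
  "has_bochner_integral P (\<lambda>\<omega>. indicator (path_set a n) \<omega> *\<^sub>R
       outer (lin_err (\<lambda>\<omega>. x0 \<omega> - xbar) w F E k \<omega>) (lin_err (\<lambda>\<omega>. x0 \<omega> - xbar) w F E k \<omega>))
     (prob (path_set a n) *\<^sub>R lin_cov \<Psi> F E k)"
proof (rule lin_err_moments)
  show "has_bochner_integral P (\<lambda>\<omega>. indicator (path_set a n) \<omega> *\<^sub>R outer (w m \<omega>) (w m' \<omega>)) 0"
    if "m \<noteq> m'" for m m'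
    using noise_moment_on_path[OF w_cross_moment[OF that]] by simp
qed (rule initial_moment_on_path initial_noise_moment_on_path
    noise_moment_on_path[OF w_second_moment])+

end

section \<open>Error moments given the cluster history\<close>

lemma observer_lin_err:
  fixes M :: "nat \<Rightarrow> 'w \<Rightarrow> real ^ 'q ^ 'n"
  assumes x_0: "\<And>\<omega>. x 0 \<omega> = x0 \<omega>"
    and x_Suc: "\<And>k \<omega>. x (Suc k) \<omega> = A (\<theta> k \<omega>) *v x k \<omega> + G (\<theta> k \<omega>) *v w k \<omega>"
    and y_eq: "\<And>k \<omega>. y k \<omega> = L (\<theta> k \<omega>) *v x k \<omega> + H (\<theta> k \<omega>) *v w k \<omega>"
    and path: "\<And>m. m < k \<Longrightarrow> \<theta> m \<omega> = a m" and gain: "\<And>m. m < k \<Longrightarrow> M m \<omega> = g m"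
  shows "x k \<omega> - observer A L \<theta> y xbar M k \<omega> = lin_err (\<lambda>\<omega>. x0 \<omega> - xbar) w
      (\<lambda>m. A (a m) - g m ** L (a m)) (\<lambda>m. G (a m) - g m ** H (a m)) k \<omega>"
  using path gain
proof (induction k)
  case 0
  then show ?case by (simp add: x_0)
next
  case (Suc k)
  then have IH: "x k \<omega> - observer A L \<theta> y xbar M k \<omega> = lin_err (\<lambda>\<omega>. x0 \<omega> - xbar) w
      (\<lambda>m. A (a m) - g m ** L (a m)) (\<lambda>m. G (a m) - g m ** H (a m)) k \<omega>" by simp
  have "\<theta> k \<omega> = a k" "M k \<omega> = g k" using Suc.prems by simp_all
  then show ?case
    by (simp add: x_Suc y_eq[of k \<omega>] algebra_simps flip: IH matrix_vector_mul_assoc)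
qed

definition cluster_of :: "nat \<Rightarrow> (nat \<Rightarrow> nat set) \<Rightarrow> nat \<Rightarrow> nat" where
  "cluster_of NC S j = (\<Sum>m=1..NC. m * indicator (S m) j)"

lemma
  assumes part: "is_partition N NC S" and j: "j \<in> {1..N}"
  shows cluster_of_range: "cluster_of NC S j \<in> {1..NC}"
    and cluster_of_eq_iff: "m \<in> {1..NC} \<Longrightarrow> cluster_of NC S j = m \<longleftrightarrow> j \<in> S m"
proof -
  have P: "partition_on {1..N} (S ` {1..NC})" and inj: "inj_on S {1..NC}"
    using part by (auto simp: is_partition_def)
  obtain n where n: "n \<in> {1..NC}" "j \<in> S n"
    using partition_onD1[OF P] j by auto
  have uniq: "m = n" if "m \<in> {1..NC}" "j \<in> S m" for m
  proof (rule inj_onD[OF inj])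
    show "S m = S n"
      using disjointD[OF partition_onD2[OF P], of "S m" "S n"] that n by auto
  qed (use that n in auto)
  have "cluster_of NC S j = (\<Sum>m\<in>{1..NC}. if m = n then n else 0)"
    unfolding cluster_of_def
  proof (rule sum.cong[OF refl])
    fix m assume m: "m \<in> {1..NC}"
    show "m * indicator (S m) j = (if m = n then n else 0)"
      using n(2) uniq[OF m] by (cases "j \<in> S m") auto
  qed
  also have "\<dots> = n" using n by simp
  finally have "cluster_of NC S j = n" .
  then show "cluster_of NC S j \<in> {1..NC}"
    "m \<in> {1..NC} \<Longrightarrow> cluster_of NC S j = m \<longleftrightarrow> j \<in> S m"
    using n uniq by metis+
qed

lemma cluster_subset:
  assumes "is_partition N NC S" "m \<in> {1..NC}" shows "S m \<subseteq> {1..N}"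
  using assms partition_onD1 unfolding is_partition_def by fastforce

locale clustered_jump_system = markov_jump_system P N \<theta> p \<pi>0 A G L H x0 xbar \<Psi> w x y
  for P :: "'w measure" and N \<theta> p \<pi>0
    and A :: "nat \<Rightarrow> real ^ 'n ^ 'n" and G :: "nat \<Rightarrow> real ^ 'r ^ 'n"
    and L :: "nat \<Rightarrow> real ^ 'n ^ 'q" and H :: "nat \<Rightarrow> real ^ 'r ^ 'q"
    and x0 xbar \<Psi> w x y +
  fixes NC :: nat and S :: "nat \<Rightarrow> nat set" and \<rho> :: "nat \<Rightarrow> 'w \<Rightarrow> nat"
  assumes partition: "is_partition N NC S"
    and rho_eq: "\<And>k \<omega>. \<rho> k \<omega> = cluster NC S \<theta> k \<omega>"
    and GH: "\<And>i. i \<in> {1..N} \<Longrightarrow> G i ** transpose (H i) = 0"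
    and HH: "\<And>i. i \<in> {1..N} \<Longrightarrow> pos_def (H i ** transpose (H i))"
begin

abbreviation "c \<equiv> cluster_of NC S"

lemma rho_cluster_of: "\<rho> k \<omega> = c (\<theta> k \<omega>)"
  by (simp add: rho_eq cluster_def cluster_of_def)

lemma rho_range: "\<omega> \<in> space P \<Longrightarrow> \<rho> k \<omega> \<in> {1..NC}"
  unfolding rho_cluster_of by (rule cluster_of_range[OF partition theta_range])

lemma rho_measurable[measurable]: "\<rho> k \<in> P \<rightarrow>\<^sub>M count_space UNIV"
proof -
  have "\<rho> k = (\<lambda>\<omega>. c (\<theta> k \<omega>))" by (simp add: fun_eq_iff rho_cluster_of)
  then show ?thesis by simp
qed

abbreviation "event \<equiv> path_event P \<rho> \<theta>"
abbreviation "q \<equiv> path_prob P \<rho> \<theta>"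

lemma event_measurable[measurable]: "event l i k \<in> sets P"
  unfolding path_event_def by measurable

text \<open>The mode paths up to time \<open>k\<close> with cluster history \<open>l\<close> and final mode \<open>i\<close>. They are functions with
  the value \<^const>\<open>undefined\<close> after \<open>k\<close>, so that each path is represented once and there are
  finitely many of them.\<close>

definition paths :: "(nat \<Rightarrow> nat) \<Rightarrow> nat \<Rightarrow> nat \<Rightarrow> (nat \<Rightarrow> nat) set" where
  "paths l i k = {a \<in> {..k} \<rightarrow>\<^sub>E {1..N}. (\<forall>m<k. c (a m) = l m) \<and> a k = i}"

lemma finite_paths: "finite (paths l i k)"
  unfolding paths_def by (rule finite_subset[OF _ finite_PiE[of "{..k}" "\<lambda>_. {1..N}"]]) auto

text \<open>Every outcome follows exactly one mode path, so the event is the disjoint union of the path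
  events.\<close>

lemma indicator_event_paths:
  assumes \<omega>: "\<omega> \<in> space P"
  shows "(indicator (event l i k) \<omega> :: real) = (\<Sum>a\<in>paths l i k. indicator (path_set a k) \<omega>)"
proof -
  let ?a = "restrict (\<lambda>m. \<theta> m \<omega>) {..k}"
  have "(\<Sum>a\<in>paths l i k. indicator (path_set a k) \<omega> :: real)
      = (\<Sum>a\<in>paths l i k. if a = ?a then 1 else 0)"
  proof (rule sum.cong[OF refl])
    fix a assume "a \<in> paths l i k"
    then have "a \<in> {..k} \<rightarrow>\<^sub>E {1..N}" by (simp add: paths_def)
    then have "\<omega> \<in> path_set a k \<longleftrightarrow> a = ?a"
      using \<omega> by (auto simp: path_set_def fun_eq_iff PiE_def extensional_def restrict_def)
    then show "(indicator (path_set a k) \<omega> :: real) = (if a = ?a then 1 else 0)"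
      by (simp add: indicator_def)
  qed
  also have "\<dots> = (if ?a \<in> paths l i k then 1 else 0)"
    by (simp add: finite_paths)
  also have "?a \<in> paths l i k \<longleftrightarrow> \<omega> \<in> event l i k"
    using \<omega> theta_range[OF \<omega>] by (auto simp: paths_def path_event_def rho_cluster_of)
  finally show ?thesis by (simp add: indicator_def)
qed

lemma path_prob_paths: "q l i k = (\<Sum>a\<in>paths l i k. prob (path_set a k))"
proof -
  have ind: "has_bochner_integral P (indicator B :: _ \<Rightarrow> real) (prob B)" if "B \<in> sets P" for B
    using that by (intro has_bochner_integral_real_indicator) (auto simp: less_top[symmetric])
  have "has_bochner_integral P (\<lambda>\<omega>. \<Sum>a\<in>paths l i k. indicator (path_set a k) \<omega>)
      (\<Sum>a\<in>paths l i k. prob (path_set a k))"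
    by (intro has_bochner_integral_sum ind path_set_measurable)
  then have "has_bochner_integral P (indicator (event l i k)) (\<Sum>a\<in>paths l i k. prob (path_set a k))"
    by (rule has_bochner_integral_cong[OF refl _ refl, THEN iffD1, rotated])
      (simp add: indicator_event_paths)
  from has_bochner_integral_eq[OF this ind[OF event_measurable]]
  show ?thesis by (simp add: path_prob_def)
qed

abbreviation "obs_err M k \<omega> \<equiv> x k \<omega> - observer A L \<theta> y xbar M k \<omega>"

text \<open>A feasible gain sequence is handled through a family of functions that produces it; on the
  discrete space of histories every function is measurable.\<close>

definition gain_rule :: "nat \<Rightarrow> (nat \<Rightarrow> 'w \<Rightarrow> real ^ 'q ^ 'n)
    \<Rightarrow> (nat \<Rightarrow> nat list \<times> nat \<Rightarrow> real ^ 'q ^ 'n) \<Rightarrow> bool" where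
  "gain_rule s M h \<longleftrightarrow>
     (\<forall>k\<le>s. \<forall>\<omega>\<in>space P. M k \<omega> = h k (map (\<lambda>m. \<rho> m \<omega>) [0..<k], \<theta> k \<omega>))"

lemma feasible_iff_gain_rule: "feasible P \<rho> \<theta> s M \<longleftrightarrow> (\<exists>h. gain_rule s M h)"
proof
  assume "feasible P \<rho> \<theta> s M"
  then have "\<forall>k. \<exists>h. k \<le> s \<longrightarrow> (\<forall>\<omega>\<in>space P. M k \<omega> = h (map (\<lambda>m. \<rho> m \<omega>) [0..<k], \<theta> k \<omega>))"
    unfolding feasible_def by blast
  then show "\<exists>h. gain_rule s M h" unfolding gain_rule_def by (metis (no_types))
qed (auto simp: feasible_def gain_rule_def)

text \<open>The coefficients of the error recursion along the mode path \<open>a\<close>.\<close>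

definition closed_loop :: "(nat \<Rightarrow> nat list \<times> nat \<Rightarrow> real ^ 'q ^ 'n) \<Rightarrow> (nat \<Rightarrow> nat) \<Rightarrow> nat \<Rightarrow> real ^ 'n ^ 'n" where
  "closed_loop h a m = A (a m) - h m (map (\<lambda>r. c (a r)) [0..<m], a m) ** L (a m)"

definition closed_loop_noise :: "(nat \<Rightarrow> nat list \<times> nat \<Rightarrow> real ^ 'q ^ 'n) \<Rightarrow> (nat \<Rightarrow> nat) \<Rightarrow> nat \<Rightarrow> real ^ 'r ^ 'n" where
  "closed_loop_noise h a m = G (a m) - h m (map (\<lambda>r. c (a r)) [0..<m], a m) ** H (a m)"

abbreviation "path_cov h a \<equiv> lin_cov \<Psi> (closed_loop h a) (closed_loop_noise h a)"

text \<open>The error at time \<open>k\<close> depends on the modes before \<open>k\<close> only, so from \<open>k\<close> on the path event \<open>b\<close> may differ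
  from the path \<open>a\<close> that determines the coefficients. In the recursion for the moments, \<open>b\<close> extends \<open>a\<close> by the
  next mode.\<close>

lemma obs_err_moment_on_path:
  assumes rule: "gain_rule s M h" and k: "k \<le> Suc s" "k \<le> Suc n" and ab: "\<And>m. m < k \<Longrightarrow> b m = a m"
  shows "has_bochner_integral P
    (\<lambda>\<omega>. indicator (path_set b n) \<omega> *\<^sub>R outer (obs_err M k \<omega>) (obs_err M k \<omega>))
    (prob (path_set b n) *\<^sub>R path_cov h a k)"
proof (rule has_bochner_integral_cong[OF refl _ refl, THEN iffD1,
      OF _ lin_err_moment_on_path[of b n "closed_loop h a" "closed_loop_noise h a" k]])
  fix \<omega> assume \<omega>: "\<omega> \<in> space P"
  let ?e = "lin_err (\<lambda>\<omega>. x0 \<omega> - xbar) w (closed_loop h a) (closed_loop_noise h a) k"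
  have "obs_err M k \<omega> = ?e \<omega>" if "\<omega> \<in> path_set b n"
  proof -
    have th: "\<theta> m \<omega> = a m" if "m < k" for m
      using \<open>\<omega> \<in> path_set b n\<close> that k ab by (auto simp: path_set_def)
    have gn: "M m \<omega> = h m (map (\<lambda>r. c (a r)) [0..<m], a m)" if "m < k" for m
    proof -
      have "map (\<lambda>m. \<rho> m \<omega>) [0..<m] = map (\<lambda>r. c (a r)) [0..<m]"
        using th that by (auto simp: rho_cluster_of)
      moreover have "M m \<omega> = h m (map (\<lambda>m. \<rho> m \<omega>) [0..<m], \<theta> m \<omega>)"
        using rule that k \<omega> by (auto simp: gain_rule_def)
      ultimately show ?thesis using th[OF that] by (simp only:)
    qed
    show ?thesis
      unfolding closed_loop_def closed_loop_noise_def
      by (rule observer_lin_err; (rule x_0 x_Suc y_eq | erule th gn))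
  qed
  then show "indicator (path_set b n) \<omega> *\<^sub>R outer (?e \<omega>) (?e \<omega>) =
      indicator (path_set b n) \<omega> *\<^sub>R outer (obs_err M k \<omega>) (obs_err M k \<omega>)"
    by (auto simp: indicator_def)
qed

abbreviation "X M \<equiv> err_moment P \<rho> \<theta> x (observer A L \<theta> y xbar M)"

lemma
  assumes "gain_rule s M h" "k \<le> s"
  shows err_moment_has_integral: "has_bochner_integral P
      (\<lambda>\<omega>. indicator (event l i k) \<omega> *\<^sub>R outer (obs_err M k \<omega>) (obs_err M k \<omega>)) (X M l i k)"
    and err_moment_paths:
      "X M l i k = (\<Sum>a\<in>paths l i k. prob (path_set a k) *\<^sub>R path_cov h a k)"
proof -
  have "has_bochner_integral P
      (\<lambda>\<omega>. \<Sum>a\<in>paths l i k. indicator (path_set a k) \<omega> *\<^sub>R outer (obs_err M k \<omega>) (obs_err M k \<omega>))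
      (\<Sum>a\<in>paths l i k. prob (path_set a k) *\<^sub>R path_cov h a k)"
    using assms by (intro has_bochner_integral_sum obs_err_moment_on_path) auto
  then have *: "has_bochner_integral P
      (\<lambda>\<omega>. indicator (event l i k) \<omega> *\<^sub>R outer (obs_err M k \<omega>) (obs_err M k \<omega>))
      (\<Sum>a\<in>paths l i k. prob (path_set a k) *\<^sub>R path_cov h a k)"
    by (rule has_bochner_integral_cong[OF refl _ refl, THEN iffD1, rotated])
      (simp add: indicator_event_paths scaleR_sum_left)
  then show "X M l i k = (\<Sum>a\<in>paths l i k. prob (path_set a k) *\<^sub>R path_cov h a k)"
    by (simp add: err_moment_def has_bochner_integral_iff)
  with * show "has_bochner_integral P
      (\<lambda>\<omega>. indicator (event l i k) \<omega> *\<^sub>R outer (obs_err M k \<omega>) (obs_err M k \<omega>)) (X M l i k)"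
    by simp
qed

lemma Psi_pos_semidef: "pos_semidef \<Psi>"
  using x0_normal by (simp add: normal_vec_def)

lemma pos_semidef_err_moment:
  assumes "gain_rule s M h" "k \<le> s" shows "pos_semidef (X M l i k)"
  unfolding err_moment_paths[OF assms]
  by (intro pos_semidef_sum pos_semidef_scaleR pos_semidef_lin_cov Psi_pos_semidef) simp

lemma err_moment_null:
  assumes "q l i k = 0" shows "X M l i k = 0"
proof -
  have "event l i k \<in> null_sets P"
    using assms by (simp add: path_prob_def null_sets_def emeasure_eq_measure)
  then have "AE \<omega> in P. indicator (event l i k) \<omega> *\<^sub>R outer (obs_err M k \<omega>) (obs_err M k \<omega>) = 0"
    by (rule AE_mp[OF AE_not_in]) (simp add: indicator_def)
  then show ?thesis unfolding err_moment_def by (rule integral_eq_zero_AE)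
qed

lemma err_moment_initial:
  assumes "gain_rule s M h" shows "X M l i 0 = q l i 0 *\<^sub>R \<Psi>"
  by (simp add: err_moment_paths[OF assms] path_prob_paths flip: scaleR_sum_left)

text \<open>The Markov property applies to full mode paths, not to cluster histories. This decomposition
  splits the event at time \<open>Suc k\<close> by the mode \<open>j\<close> at time \<open>k\<close>, which lies in the last recorded cluster,
  and by the path leading to it.\<close>

lemma indicator_event_Suc:
  assumes \<omega>: "\<omega> \<in> space P"
  shows "(indicator (event l i (Suc k)) \<omega> :: real) = (\<Sum>j\<in>{j \<in> {1..N}. c j = l k}.
     \<Sum>a\<in>paths l j k. indicator (path_set (a(Suc k := i)) (Suc k)) \<omega>)"
proof -
  have "(indicator (path_set (a(Suc k := i)) (Suc k)) \<omega> :: real)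
      = indicator (path_set a k) \<omega> * of_bool (\<theta> (Suc k) \<omega> = i)" for a
    using \<omega> by (auto simp: path_set_def indicator_def le_Suc_eq)
  then have "(\<Sum>j\<in>{j \<in> {1..N}. c j = l k}. \<Sum>a\<in>paths l j k.
        indicator (path_set (a(Suc k := i)) (Suc k)) \<omega> :: real)
      = (\<Sum>j\<in>{j \<in> {1..N}. c j = l k}. indicator (event l j k) \<omega>) * of_bool (\<theta> (Suc k) \<omega> = i)"
    by (simp only: indicator_event_paths[OF \<omega>] sum_distrib_right)
  also have "(\<Sum>j\<in>{j \<in> {1..N}. c j = l k}. indicator (event l j k) \<omega> :: real) =
      (\<Sum>j\<in>{j \<in> {1..N}. c j = l k}. if j = \<theta> k \<omega> then of_bool (\<forall>m<k. \<rho> m \<omega> = l m) else 0)"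
    by (rule sum.cong) (use \<omega> in \<open>auto simp: path_event_def indicator_def\<close>)
  also have "\<dots> * of_bool (\<theta> (Suc k) \<omega> = i) = indicator (event l i (Suc k)) \<omega>"
    using \<omega> theta_range[OF \<omega>, of k]
    by (auto simp: path_event_def indicator_def less_Suc_eq rho_cluster_of)
  finally show ?thesis ..
qed

text \<open>The gain at time \<open>k\<close> depends on the path only through the cluster history and the mode \<open>j\<close>. Hence
  all paths ending in \<open>j\<close> undergo the same error update. It is linear in the pair of the probability
  and the moment, so it can be pulled out of the sum over these paths.\<close>

lemma err_moment_Suc:
  assumes rule: "gain_rule s M h" and k: "Suc k \<le> s" and i: "i \<in> {1..N}"
  shows "X M l i (Suc k) = (\<Sum>j\<in>{j \<in> {1..N}. c j = l k}. p j i *\<^sub>R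
     error_update (A j) (G j) (L j) (H j) (h k (map l [0..<k], j)) (q l j k) (X M l j k))"
proof -
  let ?o = "\<lambda>\<omega>. outer (obs_err M (Suc k) \<omega>) (obs_err M (Suc k) \<omega>)"
  let ?C = "{j \<in> {1..N}. c j = l k}"
  have "has_bochner_integral P
      (\<lambda>\<omega>. \<Sum>j\<in>?C. \<Sum>a\<in>paths l j k. indicator (path_set (a(Suc k := i)) (Suc k)) \<omega> *\<^sub>R ?o \<omega>)
      (\<Sum>j\<in>?C. \<Sum>a\<in>paths l j k. prob (path_set (a(Suc k := i)) (Suc k)) *\<^sub>R path_cov h a (Suc k))"
    using k by (intro has_bochner_integral_sum obs_err_moment_on_path[OF rule]) auto
  then have "has_bochner_integral P (\<lambda>\<omega>. indicator (event l i (Suc k)) \<omega> *\<^sub>R ?o \<omega>)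
      (\<Sum>j\<in>?C. \<Sum>a\<in>paths l j k. prob (path_set (a(Suc k := i)) (Suc k)) *\<^sub>R path_cov h a (Suc k))"
    by (rule has_bochner_integral_cong[OF refl _ refl, THEN iffD1, rotated])
      (simp add: indicator_event_Suc scaleR_sum_left)
  then have "X M l i (Suc k) =
      (\<Sum>j\<in>?C. \<Sum>a\<in>paths l j k. prob (path_set (a(Suc k := i)) (Suc k)) *\<^sub>R path_cov h a (Suc k))"
    by (simp add: err_moment_def has_bochner_integral_iff)
  also have "\<dots> = (\<Sum>j\<in>?C. p j i *\<^sub>R
     error_update (A j) (G j) (L j) (H j) (h k (map l [0..<k], j)) (q l j k) (X M l j k))"
  proof (rule sum.cong[OF refl])
    fix j
    let ?g = "h k (map l [0..<k], j)"
    let ?F = "A j - ?g ** L j" and ?E = "G j - ?g ** H j"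
    have "prob (path_set (a(Suc k := i)) (Suc k)) *\<^sub>R path_cov h a (Suc k) =
        p j i *\<^sub>R (?F ** (prob (path_set a k) *\<^sub>R path_cov h a k) ** transpose ?F
          + prob (path_set a k) *\<^sub>R (?E ** transpose ?E))"
      if a: "a \<in> paths l j k" for a
    proof -
      have "map (\<lambda>r. c (a r)) [0..<k] = map l [0..<k]" "a k = j"
        using a by (auto simp: paths_def)
      then have "closed_loop h a k = ?F" "closed_loop_noise h a k = ?E"
        by (simp_all only: closed_loop_def closed_loop_noise_def)
      then show ?thesis
        using \<open>a k = j\<close> by (simp add: prob_path_set_step[OF i] scaleR_mult_matrix
            mult_scaleR_matrix scaleR_add_right)
    qed
    then have "(\<Sum>a\<in>paths l j k. prob (path_set (a(Suc k := i)) (Suc k)) *\<^sub>R path_cov h a (Suc k))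
      = (\<Sum>a\<in>paths l j k. p j i *\<^sub>R (?F ** (prob (path_set a k) *\<^sub>R path_cov h a k) ** transpose ?F
          + prob (path_set a k) *\<^sub>R (?E ** transpose ?E)))"
      by (rule sum.cong[OF refl])
    also have "\<dots> = p j i *\<^sub>R error_update (A j) (G j) (L j) (H j) ?g (q l j k) (X M l j k)"
      using k by (simp add: error_update_def err_moment_paths[OF rule] path_prob_paths
          matrix_mult_sum_left matrix_mult_sum_right sum.distrib
          flip: scaleR_sum_left scaleR_sum_right)
    finally show "(\<Sum>a\<in>paths l j k. prob (path_set (a(Suc k := i)) (Suc k)) *\<^sub>R path_cov h a (Suc k))
      = p j i *\<^sub>R error_update (A j) (G j) (L j) (H j) ?g (q l j k) (X M l j k)" .
  qed
  finally show ?thesis .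
qed

end

section \<open>Optimality of the Riccati gains\<close>

context clustered_jump_system begin

abbreviation "Y l k \<equiv> riccati A G L H p \<pi>0 \<Psi> S q l k"

lemma event_cong: "(\<And>m. m < k \<Longrightarrow> l m = l' m) \<Longrightarrow> event l i k = event l' i k"
  by (auto simp: path_event_def)

lemma path_prob_cong: "(\<And>m. m < k \<Longrightarrow> l m = l' m) \<Longrightarrow> q l i k = q l' i k"
  unfolding path_prob_def by (metis event_cong)

lemma riccati_cong:
  assumes "\<And>m. m < k \<Longrightarrow> l m = l' m" shows "Y l k i = Y l' k i"
  using assms
proof (induction k arbitrary: i)
  case (Suc k)
  have "q l j (Suc k) = q l' j (Suc k)" "q l j k = q l' j k" "Y l k j = Y l' k j" "l k = l' k" for j
    using Suc by (auto intro!: path_prob_cong)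
  then show ?case by simp
qed simp

definition opt_gain :: "(nat \<Rightarrow> nat) \<Rightarrow> nat \<Rightarrow> nat \<Rightarrow> real ^ 'q ^ 'n" where
  "opt_gain l i k =
     (if q l i k = 0 then 0 else riccati_gain (A i) (L i) (H i) (q l i k) (Y l k i))"

lemma opt_gain_cong: "(\<And>m. m < k \<Longrightarrow> l m = l' m) \<Longrightarrow> opt_gain l i k = opt_gain l' i k"
  unfolding opt_gain_def using path_prob_cong[of k l l'] riccati_cong[of k l l'] by simp

text \<open>The optimal gains as functions of the recorded history. The values of \<open>nth ls\<close> beyond the length \<open>k\<close>
  of \<open>ls\<close> are unspecified, but the gain at time \<open>k\<close> reads only the entries below \<open>k\<close>.\<close>

definition opt_rule :: "nat \<Rightarrow> nat list \<times> nat \<Rightarrow> real ^ 'q ^ 'n" where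
  "opt_rule k = (\<lambda>(ls, i). opt_gain (nth ls) i k)"

lemma opt_rule_map: "opt_rule k (map l [0..<k], i) = opt_gain l i k"
  unfolding opt_rule_def by (simp, rule opt_gain_cong) simp

lemma gain_rule_opt: "gain_rule s (\<lambda>k \<omega>. opt_gain (\<lambda>m. \<rho> m \<omega>) (\<theta> k \<omega>) k) opt_rule"
  by (simp add: gain_rule_def opt_rule_map)

lemma path_prob_nonneg: "0 \<le> q l i k"
  by (simp add: path_prob_def)

lemma transition_nonneg: "j \<in> {1..N} \<Longrightarrow> i \<in> {1..N} \<Longrightarrow> 0 \<le> p j i"
  using chain by (simp add: markov_chain_def)

lemma path_prob_initial: "i \<in> {1..N} \<Longrightarrow> q l i 0 = \<pi>0 i"
  using chain by (simp add: markov_chain_def path_prob_def path_event_def)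

lemma cluster_eq:
  assumes "m \<in> {1..NC}" shows "{j \<in> {1..N}. c j = m} = S m"
  using cluster_of_eq_iff[OF partition _ assms] cluster_subset[OF partition assms] by blast

text \<open>Modes \<open>j\<close> with \<open>q l j k = 0\<close> contribute nothing, since their moment vanishes too. Dropping them leaves
  the index set of the Riccati recursion.\<close>

lemma err_moment_Suc_positive:
  assumes rule: "gain_rule s M h" and k: "Suc k \<le> s" and i: "i \<in> {1..N}" and l: "l k \<in> {1..NC}"
  shows "X M l i (Suc k) = (\<Sum>j\<in>{j \<in> S (l k). q l j k \<noteq> 0}. p j i *\<^sub>R
     error_update (A j) (G j) (L j) (H j) (h k (map l [0..<k], j)) (q l j k) (X M l j k))"
proof -
  have "finite (S (l k))"
    using cluster_subset[OF partition l] finite_subset by blast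
  then show ?thesis
    unfolding err_moment_Suc[OF rule k i] cluster_eq[OF l]
    by (intro sum.mono_neutral_right) (auto simp: err_moment_null error_update_def matrix_ring_simps)
qed

lemma riccati_Suc_eq:
  assumes i: "i \<in> {1..N}" and l: "l k \<in> {1..NC}" and nz: "q l i (Suc k) \<noteq> 0"
    and psd: "\<forall>j\<in>{1..N}. pos_semidef (Y l k j)"
  shows "Y l (Suc k) i = (\<Sum>j\<in>{j \<in> S (l k). q l j k \<noteq> 0}. p j i *\<^sub>R
     error_update (A j) (G j) (L j) (H j)
       (riccati_gain (A j) (L j) (H j) (q l j k) (Y l k j)) (q l j k) (Y l k j))"
proof -
  have "error_update (A j) (G j) (L j) (H j)
       (riccati_gain (A j) (L j) (H j) (q l j k) (Y l k j)) (q l j k) (Y l k j) =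
      A j ** Y l k j ** transpose (A j) + q l j k *\<^sub>R (G j ** transpose (G j))
      - A j ** Y l k j ** transpose (L j)
        ** matrix_inv (L j ** Y l k j ** transpose (L j) + q l j k *\<^sub>R (H j ** transpose (H j)))
        ** L j ** Y l k j ** transpose (A j)"
    if "j \<in> S (l k)" "q l j k \<noteq> 0" for j
  proof -
    have j: "j \<in> {1..N}" using that cluster_subset[OF partition l] by blast
    have "0 < q l j k" using that path_prob_nonneg[of l j k] by simp
    from error_update_riccati_gain[OF GH[OF j] HH[OF j] bspec[OF psd j] this, of "A j" "L j"]
    show ?thesis by (simp add: innovation_cov_def)
  qed
  then show ?thesis using nz by (simp add: Let_def)
qed

text \<open>Where the probability is positive, the optimal gain is the Riccati gain of \<open>Y\<close>, and by induction \<open>Y\<close> is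
  the moment it acts on, so one error update is exactly one bracket of the Riccati recursion. Being
  a moment, \<open>Y\<close> is also positive semidefinite, which completing the square requires.\<close>

lemma err_moment_optimal_eq:
  assumes rule: "gain_rule s M opt_rule"
  shows "k \<le> s \<Longrightarrow> i \<in> {1..N} \<Longrightarrow> (\<And>m. m < k \<Longrightarrow> l m \<in> {1..NC}) \<Longrightarrow> X M l i k = Y l k i"
proof (induction k arbitrary: i)
  case 0
  then show ?case by (simp add: err_moment_initial[OF rule] path_prob_initial)
next
  case (Suc k)
  then have IH: "X M l j k = Y l k j" if "j \<in> {1..N}" for j using that by simp
  have l: "l k \<in> {1..NC}" using Suc.prems by simp
  show ?case
  proof (cases "q l i (Suc k) = 0")
    case True
    then show ?thesis by (simp add: err_moment_null)
  next
    case False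
    have psd: "\<forall>j\<in>{1..N}. pos_semidef (Y l k j)"
    proof
      fix j assume "j \<in> {1..N}"
      then show "pos_semidef (Y l k j)"
        using pos_semidef_err_moment[where l=l and k=k and i=j, OF rule] IH[of j] Suc.prems by simp
    qed
    show ?thesis
      unfolding riccati_Suc_eq[where l=l and k=k, OF Suc.prems(2) l False psd]
        err_moment_Suc_positive[where l=l and k=k, OF rule Suc.prems(1) Suc.prems(2) l]
    proof (rule sum.cong[OF refl])
      fix j assume j: "j \<in> {j \<in> S (l k). q l j k \<noteq> 0}"
      then have "j \<in> {1..N}" using cluster_subset[OF partition l] by blast
      then show "p j i *\<^sub>R error_update (A j) (G j) (L j) (H j) (opt_rule k (map l [0..<k], j))
          (q l j k) (X M l j k) = p j i *\<^sub>R error_update (A j) (G j) (L j) (H j)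
          (riccati_gain (A j) (L j) (H j) (q l j k) (Y l k j)) (q l j k) (Y l k j)"
        using j by (simp add: opt_rule_map opt_gain_def IH)
    qed
  qed
qed

text \<open>The Riccati matrix is the second moment of an error, namely that of the Riccati gains.\<close>

lemma riccati_pos_semidef:
  assumes "i \<in> {1..N}" "\<And>m. m < k \<Longrightarrow> l m \<in> {1..NC}"
  shows "pos_semidef (Y l k i)"
proof -
  let ?M = "\<lambda>k \<omega>. opt_gain (\<lambda>m. \<rho> m \<omega>) (\<theta> k \<omega>) k"
  have "pos_semidef (X ?M l i k)"
    by (rule pos_semidef_err_moment[OF gain_rule_opt order_refl])
  also have "X ?M l i k = Y l k i"
    using assms by (intro err_moment_optimal_eq[OF gain_rule_opt order_refl])
  finally show ?thesis .
qed

lemma riccati_le_err_moment: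
  assumes rule: "gain_rule s M h"
  shows "k \<le> s \<Longrightarrow> i \<in> {1..N} \<Longrightarrow> (\<And>m. m < k \<Longrightarrow> l m \<in> {1..NC}) \<Longrightarrow>
    pos_semidef (X M l i k - Y l k i)"
proof (induction k arbitrary: i)
  case 0
  then show ?case by (simp add: err_moment_initial[OF rule] path_prob_initial pos_semidef_zero)
next
  case (Suc k)
  have l: "l k \<in> {1..NC}" using Suc.prems by simp
  have psd: "\<forall>j\<in>{1..N}. pos_semidef (Y l k j)"
    using riccati_pos_semidef Suc.prems by simp
  show ?case
  proof (cases "q l i (Suc k) = 0")
    case True
    then show ?thesis by (simp add: err_moment_null pos_semidef_zero)
  next
    case False
    show ?thesis
      unfolding riccati_Suc_eq[where l=l and k=k, OF Suc.prems(2) l False psd]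
        err_moment_Suc_positive[where l=l and k=k, OF rule Suc.prems(1) Suc.prems(2) l]
        sum_subtractf[symmetric] scaleR_diff_right[symmetric]
    proof (rule pos_semidef_sum)
      fix j assume j: "j \<in> {j \<in> S (l k). q l j k \<noteq> 0}"
      then have jN: "j \<in> {1..N}" using cluster_subset[OF partition l] by blast
      have "0 < q l j k" using j path_prob_nonneg[of l j k] by simp
      then show "pos_semidef (p j i *\<^sub>R
          (error_update (A j) (G j) (L j) (H j) (h k (map l [0..<k], j)) (q l j k) (X M l j k)
           - error_update (A j) (G j) (L j) (H j)
              (riccati_gain (A j) (L j) (H j) (q l j k) (Y l k j)) (q l j k) (Y l k j)))"
        using Suc jN
        by (intro pos_semidef_scaleR riccati_gain_optimal GH HH bspec[OF psd] transition_nonneg) auto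
    qed
  qed
qed

text \<open>The random variable that generates the mode information. The last cluster \<open>\<rho>(s)\<close> is left out, as
  it is a function of \<open>\<theta>(s)\<close>; this makes the values of the record correspond to the index strings of
  the moments.\<close>

definition mode_record :: "nat \<Rightarrow> 'w \<Rightarrow> nat list \<times> nat" where
  "mode_record s \<omega> = (map (\<lambda>m. \<rho> m \<omega>) [0..<s], \<theta> s \<omega>)"

text \<open>The sets that are determined by the record form a sigma-algebra, and it contains the generators of
  the mode information.\<close>

lemma mode_info_sets:
  assumes "B \<in> sets (mode_info P \<rho> \<theta> s)"
  obtains Z where "B = {\<omega> \<in> space P. mode_record s \<omega> \<in> Z}"
proof -
  let ?V = "vimage_algebra (space P) (mode_record s) (count_space UNIV)"
  have V: "{\<omega> \<in> space P. mode_record s \<omega> \<in> Z} \<in> sets ?V" for Z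
    unfolding sets_vimage_algebra2[of "mode_record s" "space P" "count_space UNIV", simplified]
    by blast
  have rho: "\<rho> k -` E \<inter> space P \<in> sets ?V" if "k \<le> s" for k E
  proof (cases "k = s")
    case True
    then have "\<rho> k -` E \<inter> space P = {\<omega> \<in> space P. mode_record s \<omega> \<in> {z. c (snd z) \<in> E}}"
      by (auto simp: mode_record_def rho_cluster_of)
    then show ?thesis by (simp only: V)
  next
    case False
    then have "\<rho> k -` E \<inter> space P = {\<omega> \<in> space P. mode_record s \<omega> \<in> {z. fst z ! k \<in> E}}"
      using that by (auto simp: mode_record_def)
    then show ?thesis by (simp only: V)
  qed
  have theta: "\<theta> s -` E \<inter> space P \<in> sets ?V" for E
  proof -
    have "\<theta> s -` E \<inter> space P = {\<omega> \<in> space P. mode_record s \<omega> \<in> {z. snd z \<in> E}}"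
      by (auto simp: mode_record_def)
    then show ?thesis by (simp only: V)
  qed
  let ?gen = "(\<Union>k\<in>{..s}. sigma_of P (count_space UNIV) (\<rho> k)) \<union> sigma_of P (count_space UNIV) (\<theta> s)"
  have "?gen \<subseteq> sets ?V" using rho theta by (auto simp: sigma_of_def)
  then have "sigma_sets (space P) ?gen \<subseteq> sets ?V"
    using sets.sigma_sets_subset[of ?gen ?V] by simp
  moreover have "sets (mode_info P \<rho> \<theta> s) = sigma_sets (space P) ?gen"
    unfolding mode_info_def by (rule sets_measure_of) (auto simp: sigma_of_def)
  ultimately have "B \<in> sets ?V" using assms by blast
  then obtain Z where "B = mode_record s -` Z \<inter> space P"
    by (auto simp: sets_vimage_algebra2)
  then have "B = {\<omega> \<in> space P. mode_record s \<omega> \<in> Z}" by blast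
  then show ?thesis using that by blast
qed

definition records :: "nat \<Rightarrow> (nat list \<times> nat) set" where
  "records s = {ls. set ls \<subseteq> {1..NC} \<and> length ls = s} \<times> {1..N}"

lemma finite_records: "finite (records s)"
  unfolding records_def by (intro finite_cartesian_product finite_lists_length_eq) auto

lemma indicator_record:
  assumes \<omega>: "\<omega> \<in> space P"
  shows "(\<Sum>(ls, i)\<in>records s \<inter> Z. indicator (event (nth ls) i s) \<omega>) =
     (of_bool (mode_record s \<omega> \<in> Z) :: real)"
proof -
  have mem: "mode_record s \<omega> \<in> records s"
    using rho_range[OF \<omega>] theta_range[OF \<omega>] by (auto simp: mode_record_def records_def)
  have "(\<Sum>(ls, i)\<in>records s \<inter> Z. indicator (event (nth ls) i s) \<omega> :: real) =
      (\<Sum>z\<in>records s \<inter> Z. if z = mode_record s \<omega> then 1 else 0)"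
  proof (rule sum.cong[OF refl], clarify)
    fix ls i assume "(ls, i) \<in> records s"
    then have "\<omega> \<in> event (nth ls) i s \<longleftrightarrow> (ls, i) = mode_record s \<omega>"
      using \<omega> by (auto simp: records_def mode_record_def path_event_def list_eq_iff_nth_eq)
    then show "(indicator (event (nth ls) i s) \<omega> :: real) = (if (ls, i) = mode_record s \<omega> then 1 else 0)"
      by (simp add: indicator_def)
  qed
  also have "\<dots> = of_bool (mode_record s \<omega> \<in> Z)" using mem finite_records by auto
  finally show ?thesis .
qed

text \<open>The squared norm is the trace of the outer product, and the trace commutes with the integral.\<close>

lemma squared_error_integral_on_record:
  assumes rule: "gain_rule s M h"
  shows "has_bochner_integral P (\<lambda>\<omega>. of_bool (mode_record s \<omega> \<in> Z) * (norm (obs_err M s \<omega>))\<^sup>2)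
    (\<Sum>(ls, i)\<in>records s \<inter> Z. trace (X M (nth ls) i s))"
proof -
  have "has_bochner_integral P (\<lambda>\<omega>. \<Sum>z\<in>records s \<inter> Z.
      trace (indicator (event (nth (fst z)) (snd z) s) \<omega> *\<^sub>R outer (obs_err M s \<omega>) (obs_err M s \<omega>)))
    (\<Sum>z\<in>records s \<inter> Z. trace (X M (nth (fst z)) (snd z) s))"
    by (intro has_bochner_integral_sum has_bochner_integral_bounded_linear[OF trace_bounded_linear]
        err_moment_has_integral[OF rule order_refl])
  then have "has_bochner_integral P (\<lambda>\<omega>. of_bool (mode_record s \<omega> \<in> Z) * (norm (obs_err M s \<omega>))\<^sup>2)
    (\<Sum>z\<in>records s \<inter> Z. trace (X M (nth (fst z)) (snd z) s))"
  proof (rule has_bochner_integral_cong[OF refl _ refl, THEN iffD1, rotated])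
    fix \<omega> assume "\<omega> \<in> space P"
    from indicator_record[OF this, of s Z]
    show "(\<Sum>z\<in>records s \<inter> Z. trace (indicator (event (nth (fst z)) (snd z) s) \<omega> *\<^sub>R
        outer (obs_err M s \<omega>) (obs_err M s \<omega>))) =
      of_bool (mode_record s \<omega> \<in> Z) * (norm (obs_err M s \<omega>))\<^sup>2"
      by (simp add: linear_scale[OF bounded_linear.linear[OF trace_bounded_linear]] trace_outer
          case_prod_beta flip: sum_distrib_right)
  qed
  then show ?thesis by (simp add: case_prod_beta)
qed

lemma subalgebra_obs_info: "subalgebra P (obs_info P \<rho> \<theta> y s)"
proof -
  have "(\<Union>k\<in>{..s}. sigma_of P (count_space UNIV) (\<rho> k)) \<union> (\<Union>k\<in>{..s}. sigma_of P borel (y k)) \<union>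
      sigma_of P (count_space UNIV) (\<theta> s) \<subseteq> sets P"
    using sigma_of_subset[OF rho_measurable] sigma_of_subset[OF y_measurable]
      sigma_of_subset[OF theta_measurable] by blast
  then show ?thesis
    unfolding obs_info_def subalgebra_def
    by (simp add: sets.space_closed sets.sigma_sets_subset order_trans[OF _ sets.space_closed])
qed

lemma subalgebra_mode_info: "subalgebra (obs_info P \<rho> \<theta> y s) (mode_info P \<rho> \<theta> s)"
proof -
  have "sigma_of P D f \<subseteq> Pow (space P)" for f :: "'w \<Rightarrow> 'x" and D
    by (auto simp: sigma_of_def)
  note sub = this[THEN subsetD, THEN PowD]
  have "sets (mode_info P \<rho> \<theta> s) \<subseteq> sets (obs_info P \<rho> \<theta> y s)"
    unfolding mode_info_def obs_info_def
    by (subst (1 2) sets_measure_of) (auto dest: sub intro!: sigma_sets_mono')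
  moreover have "space (mode_info P \<rho> \<theta> s) = space (obs_info P \<rho> \<theta> y s)"
    unfolding mode_info_def obs_info_def
    by (simp add: space_measure_of_conv)
  ultimately show ?thesis by (simp add: subalgebra_def)
qed

text \<open>The observations drop out by the tower property. A set of the mode information is a finite
  disjoint union of events that fix the record, on each of which the mean square error is a trace
  of an error moment.\<close>

lemma clmmse_opt:
  assumes opt: "gain_rule s M opt_rule"
  shows "is_clmmse P \<rho> \<theta> A L x y xbar s M"
  unfolding is_clmmse_def
proof (intro conjI allI impI)
  show "feasible P \<rho> \<theta> s M" using opt feasible_iff_gain_rule by blast
  fix M' :: "nat \<Rightarrow> 'w \<Rightarrow> real ^ 'q ^ 'n" assume "feasible P \<rho> \<theta> s M'"
  then obtain h where rule: "gain_rule s M' h" using feasible_iff_gain_rule by blast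
  let ?F = "mode_info P \<rho> \<theta> s" and ?R = "obs_info P \<rho> \<theta> y s"
  let ?f = "\<lambda>M \<omega>. (norm (obs_err M s \<omega>))\<^sup>2"
  have sub: "subalgebra P ?F"
    using subalgebra_obs_info[of s] subalgebra_mode_info[of s] by (auto simp: subalgebra_def)
  interpret finite_measure_subalgebra P ?F
    by unfold_locales (rule sub)
  have int: "integrable P (?f M'')" if "gain_rule s M'' h''" for M'' h''
    using squared_error_integral_on_record[OF that, of UNIV] by (simp add: has_bochner_integral_iff)
  have "AE \<omega> in P. real_cond_exp P ?F (?f M) \<omega> \<le> real_cond_exp P ?F (?f M') \<omega>"
  proof (rule real_cond_exp_mono_set_integral)
    show "finite_measure_subalgebra P ?F" ..
    fix B assume "B \<in> sets ?F"
    then obtain Z where Z: "B = {\<omega> \<in> space P. mode_record s \<omega> \<in> Z}" by (rule mode_info_sets)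
    have B: "(\<integral>\<omega>\<in>B. ?f M'' \<omega> \<partial>P) = (\<Sum>(ls, i)\<in>records s \<inter> Z. trace (X M'' (nth ls) i s))"
      if "gain_rule s M'' h''" for M'' h''
    proof -
      have "(\<integral>\<omega>\<in>B. ?f M'' \<omega> \<partial>P) = (\<integral>\<omega>. of_bool (mode_record s \<omega> \<in> Z) * ?f M'' \<omega> \<partial>P)"
        unfolding set_lebesgue_integral_def
        by (rule Bochner_Integration.integral_cong) (auto simp: Z indicator_def)
      then show ?thesis
        using squared_error_integral_on_record[OF that, of Z] by (simp add: has_bochner_integral_iff)
    qed
    have "trace (X M (nth ls) i s) \<le> trace (X M' (nth ls) i s)" if "(ls, i) \<in> records s" for ls i
    proof -
      have i: "i \<in> {1..N}" and l: "\<And>m. m < s \<Longrightarrow> ls ! m \<in> {1..NC}"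
        using that nth_mem by (fastforce simp: records_def)+
      have "0 \<le> trace (X M' (nth ls) i s - X M (nth ls) i s)"
        using trace_pos_semidef[OF riccati_le_err_moment[OF rule order_refl i l]]
          err_moment_optimal_eq[OF opt order_refl i l] by simp
      then show ?thesis
        by (simp add: linear_diff[OF bounded_linear.linear[OF trace_bounded_linear]])
    qed
    then show "(\<integral>\<omega>\<in>B. ?f M \<omega> \<partial>P) \<le> (\<integral>\<omega>\<in>B. ?f M' \<omega> \<partial>P)"
      unfolding B[OF opt] B[OF rule] by (intro sum_mono) auto
  qed (use int opt rule in auto)
  moreover have "AE \<omega> in P. real_cond_exp P ?F
      (cond_mse P ?R x (observer A L \<theta> y xbar M'') s) \<omega> = real_cond_exp P ?F (?f M'') \<omega>"
    if "gain_rule s M'' h''" for M'' h''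
    unfolding cond_mse_def
    by (rule real_cond_exp_nested_subalg[OF subalgebra_obs_info subalgebra_mode_info int[OF that]])
  note this[OF opt] this[OF rule]
  ultimately show "AE \<omega> in P.
      real_cond_exp P ?F (cond_mse P ?R x (observer A L \<theta> y xbar M) s) \<omega>
      \<le> real_cond_exp P ?F (cond_mse P ?R x (observer A L \<theta> y xbar M') s) \<omega>"
    by eventually_elim simp
qed

end

theorem theorem3p2:
  fixes P :: "'w measure"
    and N NC s :: nat
    and \<theta> \<rho> :: "nat \<Rightarrow> 'w \<Rightarrow> nat"
    and p :: "nat \<Rightarrow> nat \<Rightarrow> real" and \<pi>0 :: "nat \<Rightarrow> real"
    and S :: "nat \<Rightarrow> nat set"
    and A :: "nat \<Rightarrow> real ^ 'n ^ 'n" and G :: "nat \<Rightarrow> real ^ 'r ^ 'n"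
    and L :: "nat \<Rightarrow> real ^ 'n ^ 'q" and H :: "nat \<Rightarrow> real ^ 'r ^ 'q"
    and x0 :: "'w \<Rightarrow> real ^ 'n" and xbar :: "real ^ 'n" and \<Psi> :: "real ^ 'n ^ 'n"
    and w :: "nat \<Rightarrow> 'w \<Rightarrow> real ^ 'r"
    and x :: "nat \<Rightarrow> 'w \<Rightarrow> real ^ 'n" and y :: "nat \<Rightarrow> 'w \<Rightarrow> real ^ 'q"
    and q :: "(nat \<Rightarrow> nat) \<Rightarrow> nat \<Rightarrow> nat \<Rightarrow> real"
    and Y :: "(nat \<Rightarrow> nat) \<Rightarrow> nat \<Rightarrow> nat \<Rightarrow> real ^ 'n ^ 'n"
    and X :: "(nat \<Rightarrow> 'w \<Rightarrow> real ^ 'q ^ 'n) \<Rightarrow> (nat \<Rightarrow> nat) \<Rightarrow> nat \<Rightarrow> nat \<Rightarrow> real ^ 'n ^ 'n"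
    and Mstar :: "nat \<Rightarrow> 'w \<Rightarrow> real ^ 'q ^ 'n"
  assumes "prob_space P"
    and "markov_chain P N \<theta> p \<pi>0"
    and "is_partition N NC S"
    and "\<And>i. i \<in> {1..N} \<Longrightarrow> G i ** transpose (H i) = 0"
    and "\<And>i. i \<in> {1..N} \<Longrightarrow> pos_def (H i ** transpose (H i))"
    and "normal_vec P x0 xbar \<Psi>"
    and "\<And>k. w k \<in> borel_measurable P"
    and "\<And>k. (\<integral>\<omega>. w k \<omega> \<partial>P) = 0"
    and "\<And>k. (\<integral>\<omega>. outer (w k \<omega>) (w k \<omega>) \<partial>P) = mat 1"
    and "\<And>k m. k \<noteq> m \<Longrightarrow> (\<integral>\<omega>. outer (w k \<omega>) (w m \<omega>) \<partial>P) = 0"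
    and "prob_space.indep_set P
           (sigma_of P (\<Pi>\<^sub>M k\<in>UNIV. borel) (\<lambda>\<omega> k. w k \<omega>))
           (sigma_of P (borel \<Otimes>\<^sub>M (\<Pi>\<^sub>M k\<in>UNIV. count_space UNIV)) (\<lambda>\<omega>. (x0 \<omega>, \<lambda>k. \<theta> k \<omega>)))"
    and "prob_space.indep_set P
           (sigma_of P borel x0)
           (sigma_of P (\<Pi>\<^sub>M k\<in>UNIV. count_space UNIV) (\<lambda>\<omega> k. \<theta> k \<omega>))"
    and "\<And>\<omega>. x 0 \<omega> = x0 \<omega>"
    and "\<And>k \<omega>. x (Suc k) \<omega> = A (\<theta> k \<omega>) *v x k \<omega> + G (\<theta> k \<omega>) *v w k \<omega>"
    and "\<And>k \<omega>. y k \<omega> = L (\<theta> k \<omega>) *v x k \<omega> + H (\<theta> k \<omega>) *v w k \<omega>"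
    and "\<And>k \<omega>. \<rho> k \<omega> = cluster NC S \<theta> k \<omega>"
    and "\<And>l i k. q l i k = path_prob P \<rho> \<theta> l i k"
    and "\<And>l i k. Y l i k = riccati A G L H p \<pi>0 \<Psi> S q l k i"
    and "\<And>M l i k. X M l i k = err_moment P \<rho> \<theta> x (observer A L \<theta> y xbar M) l i k"
    and "\<And>k \<omega>. Mstar k \<omega> =
           (let i = \<theta> k \<omega>; l = (\<lambda>m. \<rho> m \<omega>) in
            if q l i k = 0 then 0
            else A i ** Y l i k ** transpose (L i)
                 ** matrix_inv (L i ** Y l i k ** transpose (L i)
                                + q l i k *\<^sub>R (H i ** transpose (H i))))"
  shows "is_clmmse P \<rho> \<theta> A L x y xbar s Mstar \<and>
    (\<forall>k\<le>s. \<forall>\<omega>\<in>space P. X Mstar (\<lambda>m. \<rho> m \<omega>) (\<theta> k \<omega>) k = Y (\<lambda>m. \<rho> m \<omega>) (\<theta> k \<omega>) k) \<and>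
    (\<forall>M. feasible P \<rho> \<theta> s M \<longrightarrow>
       (\<forall>k\<le>s. \<forall>\<omega>\<in>space P.
          loewner_le (X Mstar (\<lambda>m. \<rho> m \<omega>) (\<theta> k \<omega>) k) (X M (\<lambda>m. \<rho> m \<omega>) (\<theta> k \<omega>) k)))"
proof -
  interpret clustered_jump_system P N \<theta> p \<pi>0 A G L H x0 xbar \<Psi> w x y NC S \<rho>
    by (intro clustered_jump_system.intro markov_jump_system.intro markov_jump_system_axioms.intro
        clustered_jump_system_axioms.intro assms)
  have q: "q = path_prob P \<rho> \<theta>" using assms(17) by (simp add: fun_eq_iff)
  have Y: "Y l i k = riccati A G L H p \<pi>0 \<Psi> S (path_prob P \<rho> \<theta>) l k i" for l i k
    using assms(18) by (simp only: q)
  have "Mstar k \<omega> = opt_gain (\<lambda>m. \<rho> m \<omega>) (\<theta> k \<omega>) k" for k \<omega>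
    unfolding assms(20) Let_def opt_gain_def riccati_gain_def innovation_cov_def Y q ..
  then have "Mstar = (\<lambda>k \<omega>. opt_gain (\<lambda>m. \<rho> m \<omega>) (\<theta> k \<omega>) k)" by blast
  then have opt: "gain_rule s Mstar opt_rule" using gain_rule_opt by simp
  have eq: "X Mstar (\<lambda>m. \<rho> m \<omega>) (\<theta> k \<omega>) k = Y (\<lambda>m. \<rho> m \<omega>) (\<theta> k \<omega>) k"
    if "k \<le> s" "\<omega> \<in> space P" for k \<omega>
    unfolding assms(19) Y
    by (rule err_moment_optimal_eq[OF opt that(1) theta_range[OF that(2)] rho_range[OF that(2)]])
  have "loewner_le (X Mstar (\<lambda>m. \<rho> m \<omega>) (\<theta> k \<omega>) k) (X M (\<lambda>m. \<rho> m \<omega>) (\<theta> k \<omega>) k)"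
    if M: "feasible P \<rho> \<theta> s M" and k: "k \<le> s" and \<omega>: "\<omega> \<in> space P" for M k \<omega>
  proof -
    obtain h where rule: "gain_rule s M h" using M feasible_iff_gain_rule by blast
    have "pos_semidef (X M (\<lambda>m. \<rho> m \<omega>) (\<theta> k \<omega>) k - X Mstar (\<lambda>m. \<rho> m \<omega>) (\<theta> k \<omega>) k)"
      unfolding eq[OF k \<omega>] unfolding assms(19) Y
      by (rule riccati_le_err_moment[OF rule k theta_range[OF \<omega>] rho_range[OF \<omega>]])
    moreover have "pos_semidef (X M (\<lambda>m. \<rho> m \<omega>) (\<theta> k \<omega>) k)"
      "pos_semidef (X Mstar (\<lambda>m. \<rho> m \<omega>) (\<theta> k \<omega>) k)"
      unfolding assms(19)
      by (rule pos_semidef_err_moment[OF rule k] pos_semidef_err_moment[OF opt k])+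
    ultimately show ?thesis by (simp add: loewner_le_iff)
  qed
  with clmmse_opt[OF opt] eq show ?thesis by blast
qed

end
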